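(* There exist absolute constants $C,c\in(0,\infty)$ such that the following holds for every positive integer $n$. Let $p(x)=\sum_{\alpha\in\{0,1,2,3\}^n,\,|\alpha|=3}c_\alpha x^\alpha$ be a random cubic form in $n$ variables whose coefficients $c_\alpha$ are independent random variables, each uniformly distributed on $\{-1,1\}$. Then with probability at least $1-Cne^{-cn}$ we have $\|p\|_{\mathrm{cb}}\ge c\sqrt n\,\|p\|$.
   Context: $|\alpha|=\sum_i\alpha_i$ and $x^\alpha=\prod_ix_i^{\alpha_i}$. $\|p\|=\sup\{|p(x)|:x\in\{-1,1\}^n\}$. For a real form $p(x)=\sum_{|\alpha|=s}c_\alpha x^\alpha$ of degree $s$ in $N$ variables, $T_p\in\mathbb{R}^{N\times\cdots\times N}$ is the symmetric tensor $(T_p)_{i_1,\dots,i_s}=c_{e_{i_1}+\dots+e_{i_s}}/\tau(i_1,\dots,i_s)$, $\tau$ being the number of distinct permutations of $(i_1,\dots,i_s)$. For an $s$-tensor $T$, $\|T\|_{\mathrm{cb}}=\sup\|\sum_{i_1,\dots,i_s}T_{i_1,\dots,i_s}U_1(i_1)\cdots U_s(i_s)\|$ over all $k$ and $k\times k$ unitaries $U_j(i)$ (operator norm). With $(T\circ\sigma)_{i_1,\dots,i_s}=T_{i_{\sigma(1)},\dots,i_{\sigma(s)}}$, $\|p\|_{\mathrm{cb}}=\inf\{\sum_{\sigma\in S_s}\|T^\sigma\|_{\mathrm{cb}}:T_p=\sum_{\sigma\in S_s}T^\sigma\circ\sigma\}$. *)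

theory Defs
  imports "HOL-Probability.Probability" "HOL-Combinatorics.Permutations"
    "Jordan_Normal_Form.Schur_Decomposition"
begin

definition cubic_monos :: "nat \<Rightarrow> (nat \<Rightarrow> nat) set" where
  "cubic_monos n = {\<alpha>. (\<forall>i. n \<le> i \<longrightarrow> \<alpha> i = 0) \<and> (\<forall>i<n. \<alpha> i \<le> 3) \<and> (\<Sum>i<n. \<alpha> i) = 3}"

definition peval :: "nat \<Rightarrow> ((nat \<Rightarrow> nat) \<Rightarrow> real) \<Rightarrow> (nat \<Rightarrow> real) \<Rightarrow> real" where
  "peval n c x = (\<Sum>\<alpha>\<in>cubic_monos n. c \<alpha> * (\<Prod>i<n. x i ^ \<alpha> i))"

definition poly_norm :: "nat \<Rightarrow> ((nat \<Rightarrow> nat) \<Rightarrow> real) \<Rightarrow> real" where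
  "poly_norm n c = Sup ((\<lambda>x. \<bar>peval n c x\<bar>) ` (PiE {..<n} (\<lambda>_. {-1, 1})))"

definition ix3 :: "nat \<Rightarrow> nat \<Rightarrow> nat \<Rightarrow> nat \<Rightarrow> nat" where
  "ix3 i j l m = (if m = 0 then i else if m = 1 then j else l)"

definition mono3 :: "nat \<Rightarrow> nat \<Rightarrow> nat \<Rightarrow> nat \<Rightarrow> nat" where
  "mono3 i j l = (\<lambda>m. (if m = i then 1 else 0) + (if m = j then 1 else 0) + (if m = l then 1 else 0))"

definition tau3 :: "nat \<Rightarrow> nat \<Rightarrow> nat \<Rightarrow> nat" where
  "tau3 i j l = card {(ix3 i j l (\<sigma> 0), ix3 i j l (\<sigma> 1), ix3 i j l (\<sigma> 2)) | \<sigma>. \<sigma> permutes {0,1,2}}"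

type_synonym tensor3 = "nat \<Rightarrow> nat \<Rightarrow> nat \<Rightarrow> real"

definition Tp :: "((nat \<Rightarrow> nat) \<Rightarrow> real) \<Rightarrow> tensor3" where
  "Tp c i j l = c (mono3 i j l) / real (tau3 i j l)"

definition tperm :: "(nat \<Rightarrow> nat) \<Rightarrow> tensor3 \<Rightarrow> tensor3" where
  "tperm \<sigma> T i j l = T (ix3 i j l (\<sigma> 0)) (ix3 i j l (\<sigma> 1)) (ix3 i j l (\<sigma> 2))"

definition cvec_norm :: "complex vec \<Rightarrow> real" where
  "cvec_norm v = sqrt (\<Sum>i<dim_vec v. (cmod (v $ i))\<^sup>2)"

definition op_norm :: "nat \<Rightarrow> complex mat \<Rightarrow> real" where
  "op_norm k M = Sup {cvec_norm (mult_mat_vec M v) | v. v \<in> carrier_vec k \<and> cvec_norm v \<le> 1}"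

definition unitary_k :: "nat \<Rightarrow> complex mat \<Rightarrow> bool" where
  "unitary_k k U \<longleftrightarrow> U \<in> carrier_mat k k \<and> U * mat_adjoint U = 1\<^sub>m k \<and> mat_adjoint U * U = 1\<^sub>m k"

definition tensor_cb :: "nat \<Rightarrow> tensor3 \<Rightarrow> real" where
  "tensor_cb n T = Sup {op_norm k (mat k k (\<lambda>(a, b). \<Sum>i<n. \<Sum>j<n. \<Sum>l<n.
       complex_of_real (T i j l) * (U1 i * U2 j * U3 l) $$ (a, b)))
     | k U1 U2 U3. 0 < k \<and> (\<forall>i<n. unitary_k k (U1 i) \<and> unitary_k k (U2 i) \<and> unitary_k k (U3 i))}"

definition poly_cb :: "nat \<Rightarrow> ((nat \<Rightarrow> nat) \<Rightarrow> real) \<Rightarrow> real" where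
  "poly_cb n c = Inf {(\<Sum>\<sigma>\<in>{\<sigma>. \<sigma> permutes {0,1,2::nat}}. tensor_cb n (Ts \<sigma>)) | Ts.
     \<forall>i<n. \<forall>j<n. \<forall>l<n. Tp c i j l = (\<Sum>\<sigma>\<in>{\<sigma>. \<sigma> permutes {0,1,2::nat}}. tperm \<sigma> (Ts \<sigma>) i j l)}"

definition sign_coeffs :: "nat \<Rightarrow> ((nat \<Rightarrow> nat) \<Rightarrow> real) pmf" where
  "sign_coeffs n = Pi_pmf (cubic_monos n) 0 (\<lambda>_. pmf_of_set {-1, 1})"

end

theory Submission
  imports Defs
begin

text \<open>
  Let \<open>t\<close> be \<open>T\<^sub>p\<close> divided by \<open>52 \<surd>n\<close>. With high probability every slice of \<open>T\<^sub>p\<close> has operator norm at most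
  \<open>26 \<surd>n\<close>, so every slice \<open>t\<^sub>j\<close> has norm at most \<open>1/2\<close>, and a symmetric contraction of that kind is the
  real part of the unitary \<open>u = t\<^sub>j + i \<surd>(1 - t\<^sub>j\<^sup>2)\<close>. Taking \<open>U\<^sub>2(j)\<close> to be that unitary and \<open>U\<^sub>1(i)\<close>, \<open>U\<^sub>3(l)\<close>
  permutations exchanging a fixed basis vector with the \<open>i\<close>-th and \<open>l\<close>-th ones shows that the pairing of any
  tensor \<open>T\<close> with \<open>t\<close> is at most the cb-norm of \<open>T\<close>. As \<open>t\<close> is symmetric, the pairing does not see the permutations in a
  decomposition of \<open>T\<^sub>p\<close>, whence \<open>\<parallel>p\<parallel>\<^sub>c\<^sub>b\<close> is at least the pairing of \<open>T\<^sub>p\<close> with \<open>t\<close>, which is of order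
  \<open>n\<^sup>3 / \<surd>n\<close> because the entries of \<open>T\<^sub>p\<close> are bounded below in modulus. On the other hand \<open>\<parallel>p\<parallel> \<le> 2 n\<^sup>2\<close> with high
  probability. Both probabilistic bounds are Hoeffding's inequality with a union bound, over a net of the
  Euclidean ball for the slices and over the sign vectors for \<open>p\<close>.
\<close>

section \<open>Small symmetric matrices as real parts of unitaries\<close>

fun mpow :: "nat \<Rightarrow> (nat \<Rightarrow> nat \<Rightarrow> real) \<Rightarrow> nat \<Rightarrow> nat \<Rightarrow> nat \<Rightarrow> real" where
  "mpow n M 0 = (\<lambda>i j. if i = j then 1 else 0)"
| "mpow n M (Suc k) = (\<lambda>i j. \<Sum>l<n. M i l * mpow n M k l j)"

lemma mpow_add:
  assumes "i < n"
  shows "(\<Sum>l<n. mpow n M k i l * mpow n M m l j) = mpow n M (k + m) i j"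
  using assms
proof (induction k arbitrary: i)
  case 0
  have "(\<Sum>l<n. mpow n M 0 i l * mpow n M m l j) = (\<Sum>l<n. if l = i then mpow n M m l j else 0)"
    by (intro sum.cong) auto
  then show ?case using 0 by simp
next
  case (Suc k)
  have "(\<Sum>l<n. mpow n M (Suc k) i l * mpow n M m l j)
      = (\<Sum>l<n. \<Sum>r<n. M i r * (mpow n M k r l * mpow n M m l j))"
    by (simp add: sum_distrib_right mult.assoc)
  also have "\<dots> = (\<Sum>r<n. M i r * (\<Sum>l<n. mpow n M k r l * mpow n M m l j))"
    by (subst sum.swap) (simp add: sum_distrib_left)
  also have "\<dots> = (\<Sum>r<n. M i r * mpow n M (k + m) r j)"
    using Suc.IH by (intro sum.cong) auto
  finally show ?case by simp
qed

lemma mpow_1: "j < n \<Longrightarrow> mpow n M (Suc 0) i j = M i j"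
proof -
  assume j: "j < n"
  have "mpow n M (Suc 0) i j = (\<Sum>l<n. if l = j then M i l else 0)"
    unfolding mpow.simps by (intro sum.cong) auto
  then show ?thesis using j by simp
qed

lemma mpow_commute:
  assumes "i < n" "j < n"
  shows "(\<Sum>l<n. mpow n M k i l * M l j) = (\<Sum>l<n. M i l * mpow n M k l j)"
proof -
  have "(\<Sum>l<n. mpow n M k i l * M l j) = (\<Sum>l<n. mpow n M k i l * mpow n M (Suc 0) l j)"
    using assms mpow_1 by (intro sum.cong) auto
  also have "\<dots> = mpow n M (Suc k) i j"
    using mpow_add[OF assms(1), of M k "Suc 0" j] by simp
  finally show ?thesis by simp
qed

lemma mpow_sym:
  assumes sym: "\<And>i j. i < n \<Longrightarrow> j < n \<Longrightarrow> M i j = M j i"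
  shows "i < n \<Longrightarrow> j < n \<Longrightarrow> mpow n M k i j = mpow n M k j i"
proof (induction k arbitrary: i j)
  case (Suc k)
  have "mpow n M (Suc k) i j = (\<Sum>l<n. mpow n M k j l * M l i)"
    using Suc sym by (auto intro!: sum.cong)
  also have "\<dots> = mpow n M (Suc k) j i"
    using mpow_commute Suc.prems by simp
  finally show ?case .
qed auto

text \<open>Column \<open>j\<close> of the \<open>k\<close>-th power arises by applying
  \<open>M\<close> to the \<open>j\<close>-th unit vector \<open>k\<close> times. Each application
  multiplies the Euclidean norm by at most \<open>q\<close>, and that norm dominates every entry of
  the column.\<close>

lemma mpow_bound:
  assumes b: "\<And>y. L2_set (\<lambda>i. \<Sum>l<n. M i l * y l) {..<n} \<le> q * L2_set y {..<n}"
    and q: "0 \<le> q" and "i < n" "j < n"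
  shows "\<bar>mpow n M k i j\<bar> \<le> q ^ k"
proof -
  have "L2_set (\<lambda>i. mpow n M k i j) {..<n} \<le> q ^ k"
  proof (induction k)
    case 0
    have "(\<Sum>i<n. (if i = j then 1 else 0 :: real)\<^sup>2) = (\<Sum>i<n. if i = j then 1 else 0)"
      by (intro sum.cong) auto
    then show ?case using assms by (simp add: L2_set_def)
  next
    case (Suc k)
    have "L2_set (\<lambda>i. mpow n M (Suc k) i j) {..<n} \<le> q * L2_set (\<lambda>i. mpow n M k i j) {..<n}"
      using b[of "\<lambda>l. mpow n M k l j"] by simp
    also have "\<dots> \<le> q * q ^ k"
      using Suc q by (intro mult_left_mono)
    finally show ?case by simp
  qed
  moreover have "\<bar>mpow n M k i j\<bar> \<le> L2_set (\<lambda>i. mpow n M k i j) {..<n}"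
    using member_le_L2_set[of "{..<n}" i "\<lambda>i. \<bar>mpow n M k i j\<bar>"] assms
    by (simp add: L2_set_def)
  ultimately show ?thesis by linarith
qed

text \<open>Consecutive coefficients have ratio (1/2 - k) / (k + 1), of modulus at most 1.\<close>

lemma abs_gbinomial_half_le_1: "\<bar>(1/2 :: real) gchoose k\<bar> \<le> 1"
proof (induction k)
  case (Suc k)
  have "((1/2 :: real) gchoose Suc k) = ((1/2) gchoose k) * ((1/2 - real k) / real (Suc k))"
    using gbinomial_mult_1[of "1/2::real" k]
    by (simp add: field_simps del: of_nat_Suc)
  moreover have "\<bar>(1/2 - real k) / real (Suc k)\<bar> \<le> 1"
    by (simp add: abs_le_iff field_simps)
  ultimately show ?case using Suc
    by (simp only: abs_mult) (metis abs_ge_zero mult_le_one)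
qed auto

text \<open>
  The binomial series of \<open>\<surd>(1 - M\<^sup>2)\<close> converges geometrically for \<open>\<parallel>M\<parallel> \<le> 1/2\<close>; the factor \<open>1/2\<close> is what makes an
  entrywise argument with Cauchy products and Vandermonde's identity possible, without a spectral theorem.
\<close>

lemma exists_sqrt_one_minus_square:
  fixes M :: "nat \<Rightarrow> nat \<Rightarrow> real"
  assumes sym: "\<And>i j. i < n \<Longrightarrow> j < n \<Longrightarrow> M i j = M j i"
    and b: "\<And>y. L2_set (\<lambda>i. \<Sum>l<n. M i l * y l) {..<n} \<le> 1/2 * L2_set y {..<n}"
  obtains S where
    "\<And>i j. i < n \<Longrightarrow> j < n \<Longrightarrow> S i j = S j i"
    "\<And>i j. i < n \<Longrightarrow> j < n \<Longrightarrow> (\<Sum>l<n. S i l * M l j) = (\<Sum>l<n. M i l * S l j)"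
    "\<And>i j. i < n \<Longrightarrow> j < n \<Longrightarrow>
       (\<Sum>l<n. M i l * M l j) + (\<Sum>l<n. S i l * S l j) = (if i = j then 1 else 0)"
proof -
  \<comment> \<open>The Taylor coefficients of sqrt(1 - x); substituting the square of
    \<open>M\<close> for x gives the even powers in \<open>f\<close>.\<close>
  define a where "a k = (-1) ^ k * ((1/2 :: real) gchoose k)" for k
  define f where "f i j k = a k * mpow n M (2 * k) i j" for i j k
  define S where "S i j = (\<Sum>k. f i j k)" for i j
  have f_le: "norm (f i j k) \<le> (1/4) ^ k" if "i < n" "j < n" for i j k
  proof -
    have "\<bar>mpow n M (2 * k) i j\<bar> \<le> (1/2) ^ (2 * k)"
      using b that by (intro mpow_bound) auto
    also have "\<dots> = (1/4) ^ k"
      by (simp add: power_mult power_divide)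
    finally have 1: "\<bar>mpow n M (2 * k) i j\<bar> \<le> (1/4) ^ k" .
    have "\<bar>a k\<bar> \<le> 1"
      using abs_gbinomial_half_le_1[of k] by (simp add: a_def abs_mult power_abs)
    then have "\<bar>a k\<bar> * \<bar>mpow n M (2 * k) i j\<bar> \<le> 1 * (1/4) ^ k"
      using 1 by (intro mult_mono) auto
    then show ?thesis by (simp add: f_def abs_mult)
  qed
  have sn: "summable (\<lambda>k. norm (f i j k))" if "i < n" "j < n" for i j
    by (rule summable_comparison_test'[of "\<lambda>k. (1/4::real)^k" 0]) (use f_le that in auto)
  have sm: "f i j sums S i j" if "i < n" "j < n" for i j
    using summable_norm_cancel[OF sn[OF that]] unfolding S_def by (rule summable_sums)
  \<comment> \<open>Coefficientwise form of sqrt(1 - x) * sqrt(1 - x) = 1 - x: Vandermonde turns the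
    convolution into a binomial coefficient of upper index 1/2 + 1/2 = 1.\<close>
  have a_conv: "(\<Sum>k\<le>m. a k * a (m - k)) = (if m = 0 then 1 else if m = 1 then -1 else 0)" for m
  proof -
    have "(\<Sum>k\<le>m. a k * a (m - k)) = (-1) ^ m * (\<Sum>k\<in>{0..m}. (1/2 gchoose k) * (1/2 gchoose (m - k)))"
      unfolding sum_distrib_left atMost_atLeast0
      by (intro sum.cong) (auto simp: a_def algebra_simps simp flip: power_add)
    also have "\<dots> = (-1) ^ m * ((1::real) gchoose m)"
      by (simp add: gbinomial_Vandermonde)
    also have "((1::real) gchoose m) = real (1 choose m)"
      by (simp add: binomial_gbinomial)
    finally show ?thesis by (cases m rule: nat.exhaust[case_names 0 Suc]; cases "m = 1") auto
  qed
  show thesis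
  proof
    show "S i j = S j i" if "i < n" "j < n" for i j
      using mpow_sym[OF sym that] by (simp add: S_def f_def)
    show "(\<Sum>l<n. S i l * M l j) = (\<Sum>l<n. M i l * S l j)" if "i < n" "j < n" for i j
    proof -
      have "(\<lambda>k. \<Sum>l<n. f i l k * M l j) sums (\<Sum>l<n. S i l * M l j)"
        using sm that by (intro sums_sum sums_mult2) auto
      moreover have "(\<lambda>k. \<Sum>l<n. M i l * f l j k) sums (\<Sum>l<n. M i l * S l j)"
        using sm that by (intro sums_sum sums_mult) auto
      moreover have "(\<Sum>l<n. f i l k * M l j) = (\<Sum>l<n. M i l * f l j k)" for k
        using mpow_commute[OF that, of M "2*k"]
        by (simp add: f_def mult.assoc mult.left_commute flip: sum_distrib_left)
      ultimately show ?thesis by (simp add: sums_iff)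
    qed
    show "(\<Sum>l<n. M i l * M l j) + (\<Sum>l<n. S i l * S l j) = (if i = j then 1 else 0)"
      if "i < n" "j < n" for i j
    proof -
      \<comment> \<open>Each product of two entry series is a Cauchy product, legitimate by absolute
        convergence. After summation over \<open>l\<close>, only the terms \<open>m = 0\<close> and
        \<open>m = 1\<close> survive, which leaves the identity minus the square of
        \<open>M\<close>.\<close>
      have "(\<lambda>m. \<Sum>l<n. \<Sum>k\<le>m. f i l k * f l j (m - k)) sums (\<Sum>l<n. S i l * S l j)"
        using that unfolding S_def by (intro sums_sum Cauchy_product_sums sn) auto
      moreover have "(\<Sum>l<n. \<Sum>k\<le>m. f i l k * f l j (m - k))
          = (if m = 0 then 1 else if m = 1 then -1 else 0) * mpow n M (2 * m) i j" for m
      proof -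
        have "(\<Sum>l<n. \<Sum>k\<le>m. f i l k * f l j (m - k))
          = (\<Sum>k\<le>m. a k * a (m - k) * (\<Sum>l<n. mpow n M (2 * k) i l * mpow n M (2 * (m - k)) l j))"
          by (subst sum.swap) (simp add: f_def sum_distrib_left mult_ac)
        also have "\<dots> = (\<Sum>k\<le>m. a k * a (m - k) * mpow n M (2 * m) i j)"
          using mpow_add[OF that(1)] by (intro sum.cong refl) (simp flip: distrib_left)
        finally show ?thesis by (simp add: a_conv flip: sum_distrib_right)
      qed
      moreover have "(\<lambda>m. (if m = 0 then 1 else if m = 1 then -1 else 0) * mpow n M (2 * m) i j)
          sums (\<Sum>m\<in>{0,1}. (if m = 0 then 1 else if m = 1 then -1 else 0) * mpow n M (2 * m) i j)"
        by (intro sums_finite) auto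
      ultimately have "(\<Sum>l<n. S i l * S l j) = mpow n M 0 i j - mpow n M 2 i j"
        by (simp add: sums_iff)
      moreover have "mpow n M 2 i j = (\<Sum>l<n. M i l * M l j)"
        using mpow_1[OF that(2)] by (simp add: numeral_2_eq_2)
      ultimately show ?thesis by simp
    qed
  qed
qed

text \<open>Take U = M + iS with S the square root just built. As M and S are real and symmetric,
  the adjoint is M - iS. The real part of either product is M^2 + S^2 = 1, and the imaginary part is
  a commutator of M and S, hence zero.\<close>

lemma exists_unitary_with_Re:
  fixes M :: "nat \<Rightarrow> nat \<Rightarrow> real"
  assumes sym: "\<And>i j. i < n \<Longrightarrow> j < n \<Longrightarrow> M i j = M j i"
    and b: "\<And>y. L2_set (\<lambda>i. \<Sum>l<n. M i l * y l) {..<n} \<le> 1/2 * L2_set y {..<n}"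
  obtains U where "unitary_k n U" "\<And>i j. i < n \<Longrightarrow> j < n \<Longrightarrow> Re (U $$ (i, j)) = M i j"
proof -
  obtain S where S: "\<And>i j. i < n \<Longrightarrow> j < n \<Longrightarrow> S i j = S j i"
    "\<And>i j. i < n \<Longrightarrow> j < n \<Longrightarrow> (\<Sum>l<n. S i l * M l j) = (\<Sum>l<n. M i l * S l j)"
    "\<And>i j. i < n \<Longrightarrow> j < n \<Longrightarrow>
       (\<Sum>l<n. M i l * M l j) + (\<Sum>l<n. S i l * S l j) = (if i = j then 1 else 0)"
    using exists_sqrt_one_minus_square[of n M] sym b by blast
  define U where "U = mat n n (\<lambda>(i,j). Complex (M i j) (S i j))"
  define V where "V = mat n n (\<lambda>(i,j). Complex (M i j) (- S i j))"
  have adj: "mat_adjoint U = V"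
    using S(1) sym
    by (intro eq_matI) (auto simp: mat_adjoint_def U_def V_def mat_of_rows_def complex_eq_iff)
  have "U * V = 1\<^sub>m n"
    by (rule eq_matI)
      (auto simp: U_def V_def scalar_prod_def complex_eq_iff atLeast0LessThan sum.distrib sum_subtractf
         sum_negf S(2) S(3))
  moreover have "V * U = 1\<^sub>m n"
    by (rule eq_matI)
      (auto simp: U_def V_def scalar_prod_def complex_eq_iff atLeast0LessThan sum.distrib sum_subtractf
         sum_negf S(2) S(3))
  ultimately have "unitary_k n U"
    by (auto simp: unitary_k_def adj) (simp add: U_def)
  then show thesis by (rule that) (simp add: U_def)
qed

section \<open>Lower bounds for completely bounded norms\<close>

lemma L2_set_norm_sum:
  "L2_set (\<lambda>a. norm (\<Sum>x\<in>X. f x a)) A \<le> (\<Sum>x\<in>X. L2_set (\<lambda>a. norm (f x a)) A)"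
proof (induction X rule: infinite_finite_induct)
  case (insert x X)
  have "L2_set (\<lambda>a. norm (\<Sum>x\<in>insert x X. f x a)) A
      \<le> L2_set (\<lambda>a. norm (f x a) + norm (\<Sum>x\<in>X. f x a)) A"
    using insert by (intro L2_set_mono) (auto intro: norm_triangle_ineq)
  also have "\<dots> \<le> L2_set (\<lambda>a. norm (f x a)) A + L2_set (\<lambda>a. norm (\<Sum>x\<in>X. f x a)) A"
    by (rule L2_set_triangle_ineq)
  finally show ?case using insert by simp
qed (auto simp: L2_set_def)

lemma cvec_norm_L2_set: "cvec_norm v = L2_set (\<lambda>i. cmod (v $ i)) {..<dim_vec v}"
  by (simp add: cvec_norm_def L2_set_def)

lemma cmod_index_le_cvec_norm: "i < dim_vec v \<Longrightarrow> cmod (v $ i) \<le> cvec_norm v"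
  using member_le_L2_set[of "{..<dim_vec v}" i "\<lambda>i. cmod (v $ i)"] by (simp add: cvec_norm_L2_set)

lemma cvec_norm_unitary:
  assumes U: "unitary_k k U" and v: "v \<in> carrier_vec k"
  shows "cvec_norm (U *\<^sub>v v) = cvec_norm v"
proof -
  have UC: "U \<in> carrier_mat k k" and I: "mat_adjoint U * U = 1\<^sub>m k"
    using U by (auto simp: unitary_k_def)
  have orth: "(\<Sum>i<k. cnj (U $$ (i,l)) * U $$ (i,j)) = (if l = j then 1 else 0)"
    if "l < k" "j < k" for l j
    using arg_cong[OF I, of "\<lambda>A. A $$ (l, j)"] UC that
    by (simp add: mat_adjoint_def mat_of_rows_def scalar_prod_def atLeast0LessThan)
  have "complex_of_real (\<Sum>i<k. (cmod ((U *\<^sub>v v) $ i))\<^sup>2)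
      = (\<Sum>i<k. (\<Sum>j<k. U $$ (i,j) * v $ j) * cnj (\<Sum>l<k. U $$ (i,l) * v $ l))"
    unfolding of_real_sum using UC v
    by (intro sum.cong refl, subst complex_norm_square)
      (simp add: scalar_prod_def atLeast0LessThan)
  also have "\<dots> = (\<Sum>i<k. \<Sum>j<k. \<Sum>l<k. v $ j * cnj (v $ l) * (cnj (U $$ (i,l)) * U $$ (i,j)))"
    by (simp add: sum_product algebra_simps)
  also have "\<dots> = (\<Sum>j<k. \<Sum>i<k. \<Sum>l<k. v $ j * cnj (v $ l) * (cnj (U $$ (i,l)) * U $$ (i,j)))"
    by (rule sum.swap)
  also have "\<dots> = (\<Sum>j<k. \<Sum>l<k. v $ j * cnj (v $ l) * (\<Sum>i<k. cnj (U $$ (i,l)) * U $$ (i,j)))"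
    unfolding sum_distrib_left by (intro sum.cong refl sum.swap)
  also have "\<dots> = (\<Sum>j<k. \<Sum>l<k. if l = j then v $ j * cnj (v $ l) else 0)"
    using orth by (intro sum.cong refl) auto
  also have "\<dots> = (\<Sum>j<k. v $ j * cnj (v $ j))"
    by simp
  also have "\<dots> = complex_of_real (\<Sum>j<k. (cmod (v $ j))\<^sup>2)"
    unfolding of_real_sum by (intro sum.cong refl) (rule complex_norm_square[symmetric])
  finally show ?thesis
    using UC v by (simp only: of_real_eq_iff cvec_norm_def) simp
qed

text \<open>The matrix inside \<open>tensor_cb\<close>, named so that it can be estimated before any
  supremum is taken.\<close>

definition tensor_mat :: "nat \<Rightarrow> tensor3 \<Rightarrow> nat \<Rightarrow> (nat \<Rightarrow> complex mat) \<Rightarrow> (nat \<Rightarrow> complex mat)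
    \<Rightarrow> (nat \<Rightarrow> complex mat) \<Rightarrow> complex mat" where
  "tensor_mat n T k U1 U2 U3 = mat k k (\<lambda>(a, b). \<Sum>i<n. \<Sum>j<n. \<Sum>l<n.
       complex_of_real (T i j l) * (U1 i * U2 j * U3 l) $$ (a, b))"

text \<open>A crude triangle inequality. Its use is that the bound depends neither on
  \<open>k\<close> nor on the unitaries, so the suprema in \<open>op_norm\<close> and
  \<open>tensor_cb\<close> range over sets bounded above and do dominate their members.\<close>

lemma tensor_mat_norm_le:
  assumes U: "\<forall>i<n. unitary_k k (U1 i) \<and> unitary_k k (U2 i) \<and> unitary_k k (U3 i)"
    and v: "v \<in> carrier_vec k" "cvec_norm v \<le> 1"
  shows "cvec_norm (tensor_mat n T k U1 U2 U3 *\<^sub>v v) \<le> (\<Sum>i<n. \<Sum>j<n. \<Sum>l<n. \<bar>T i j l\<bar>)"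
proof -
  define w where "w i j l = (U1 i * U2 j * U3 l) *\<^sub>v v" for i j l
  have C: "U1 i \<in> carrier_mat k k" "U2 i \<in> carrier_mat k k" "U3 i \<in> carrier_mat k k" if "i < n" for i
    using U that by (auto simp: unitary_k_def)
  have w_norm: "cvec_norm (w i j l) \<le> 1" and w_dim: "dim_vec (w i j l) = k"
    if "i < n" "j < n" "l < n" for i j l
  proof -
    have "w i j l = U1 i *\<^sub>v (U2 j *\<^sub>v (U3 l *\<^sub>v v))"
      unfolding w_def using C[OF that(1)] C[OF that(2)] C[OF that(3)] v(1)
      by (simp add: assoc_mult_mat_vec[of _ k k _ k])
    moreover have "cvec_norm (U1 i *\<^sub>v (U2 j *\<^sub>v (U3 l *\<^sub>v v))) = cvec_norm v"
      using U C that v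
      by (metis cvec_norm_unitary mult_mat_vec_carrier)
    ultimately show "cvec_norm (w i j l) \<le> 1" using v by simp
    show "dim_vec (w i j l) = k" unfolding w_def using C[OF that(1)] by simp
  qed
  have "(tensor_mat n T k U1 U2 U3 *\<^sub>v v) $ a = (\<Sum>i<n. \<Sum>j<n. \<Sum>l<n. T i j l * w i j l $ a)"
    if a: "a < k" for a
  proof -
    have "(tensor_mat n T k U1 U2 U3 *\<^sub>v v) $ a
      = (\<Sum>b<k. \<Sum>i<n. \<Sum>j<n. \<Sum>l<n. T i j l * ((U1 i * U2 j * U3 l) $$ (a, b) * v $ b))"
      using a v by (simp add: tensor_mat_def scalar_prod_def atLeast0LessThan sum_distrib_right mult.assoc)
    also have "\<dots> = (\<Sum>i<n. \<Sum>b<k. \<Sum>j<n. \<Sum>l<n. T i j l * ((U1 i * U2 j * U3 l) $$ (a, b) * v $ b))"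
      by (rule sum.swap)
    also have "\<dots> = (\<Sum>i<n. \<Sum>j<n. \<Sum>b<k. \<Sum>l<n. T i j l * ((U1 i * U2 j * U3 l) $$ (a, b) * v $ b))"
      by (intro sum.cong refl sum.swap)
    also have "\<dots> = (\<Sum>i<n. \<Sum>j<n. \<Sum>l<n. \<Sum>b<k. T i j l * ((U1 i * U2 j * U3 l) $$ (a, b) * v $ b))"
      by (intro sum.cong refl sum.swap)
    also have "\<dots> = (\<Sum>i<n. \<Sum>j<n. \<Sum>l<n. T i j l * w i j l $ a)"
    proof (intro sum.cong refl)
      fix i j l assume "i \<in> {..<n}" "j \<in> {..<n}" "l \<in> {..<n}"
      then have "dim_row (U1 i) = k" "dim_col (U3 l) = k" using C by auto
      then show "(\<Sum>b<k. T i j l * ((U1 i * U2 j * U3 l) $$ (a, b) * v $ b)) = T i j l * w i j l $ a"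
        using a v unfolding w_def
        by (simp add: scalar_prod_def atLeast0LessThan sum_distrib_left del: index_mult_mat(1))
    qed
    finally show ?thesis .
  qed
  moreover have "dim_vec (tensor_mat n T k U1 U2 U3 *\<^sub>v v) = k"
    by (simp add: tensor_mat_def)
  ultimately have "cvec_norm (tensor_mat n T k U1 U2 U3 *\<^sub>v v)
      = L2_set (\<lambda>a. cmod (\<Sum>i<n. \<Sum>j<n. \<Sum>l<n. T i j l * w i j l $ a)) {..<k}"
    unfolding cvec_norm_L2_set by (intro L2_set_cong) simp_all
  also have "\<dots> \<le> (\<Sum>i<n. \<Sum>j<n. \<Sum>l<n. L2_set (\<lambda>a. cmod (T i j l * w i j l $ a)) {..<k})"
    by (rule order_trans[OF L2_set_norm_sum], rule sum_mono)+ (rule order_refl)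
  also have "\<dots> \<le> (\<Sum>i<n. \<Sum>j<n. \<Sum>l<n. \<bar>T i j l\<bar>)"
  proof (intro sum_mono)
    fix i j l assume "i \<in> {..<n}" "j \<in> {..<n}" "l \<in> {..<n}"
    then have "cvec_norm (w i j l) \<le> 1" "dim_vec (w i j l) = k"
      using w_norm w_dim by simp_all
    then have "\<bar>T i j l\<bar> * L2_set (\<lambda>a. cmod (w i j l $ a)) {..<k} \<le> \<bar>T i j l\<bar>"
      unfolding cvec_norm_L2_set by (simp add: mult_left_le)
    then show "L2_set (\<lambda>a. cmod (T i j l * w i j l $ a)) {..<k} \<le> \<bar>T i j l\<bar>"
      by (simp only: norm_mult norm_of_real L2_set_right_distrib abs_ge_zero)
  qed
  finally show ?thesis .
qed

text \<open>An entry in column \<open>b\<close> is a coordinate of the image of the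
  \<open>b\<close>-th unit vector, which the operator norm controls.\<close>

lemma cmod_tensor_mat_index_le:
  assumes U: "\<forall>i<n. unitary_k k (U1 i) \<and> unitary_k k (U2 i) \<and> unitary_k k (U3 i)"
    and ab: "a < k" "b < k"
  shows "cmod (tensor_mat n T k U1 U2 U3 $$ (a, b)) \<le> tensor_cb n T"
proof -
  let ?B = "\<Sum>i<n. \<Sum>j<n. \<Sum>l<n. \<bar>T i j l\<bar>"
  have op: "op_norm k' (tensor_mat n T k' V1 V2 V3) \<le> ?B"
    if V: "\<forall>i<n. unitary_k k' (V1 i) \<and> unitary_k k' (V2 i) \<and> unitary_k k' (V3 i)" for k' V1 V2 V3
    unfolding op_norm_def
  proof (rule cSup_least)
    have "cvec_norm (0\<^sub>v k') \<le> 1" by (simp add: cvec_norm_def)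
    then show "{cvec_norm (tensor_mat n T k' V1 V2 V3 *\<^sub>v v) |v. v \<in> carrier_vec k' \<and> cvec_norm v \<le> 1} \<noteq> {}"
      by (auto intro!: exI[of _ "0\<^sub>v k'"])
  qed (use tensor_mat_norm_le[OF V] in auto)
  have e: "cvec_norm (unit_vec k b) \<le> 1"
  proof -
    have "(\<Sum>i<k. (cmod (unit_vec k b $ i))\<^sup>2) = (\<Sum>i<k. if i = b then 1 else 0)"
      by (intro sum.cong) (auto simp: unit_vec_def)
    then show ?thesis using ab by (simp add: cvec_norm_def)
  qed
  have "cmod (tensor_mat n T k U1 U2 U3 $$ (a, b)) = cmod ((tensor_mat n T k U1 U2 U3 *\<^sub>v unit_vec k b) $ a)"
    using ab by (simp add: tensor_mat_def scalar_prod_right_unit)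
  also have "\<dots> \<le> cvec_norm (tensor_mat n T k U1 U2 U3 *\<^sub>v unit_vec k b)"
    using ab by (intro cmod_index_le_cvec_norm) (simp add: tensor_mat_def)
  also have "\<dots> \<le> op_norm k (tensor_mat n T k U1 U2 U3)"
    unfolding op_norm_def
  proof (rule cSup_upper)
    show "bdd_above {cvec_norm (tensor_mat n T k U1 U2 U3 *\<^sub>v v) |v. v \<in> carrier_vec k \<and> cvec_norm v \<le> 1}"
      using tensor_mat_norm_le[OF U] by (intro bdd_aboveI[of _ ?B]) auto
  qed (use e in \<open>auto intro!: exI[of _ "unit_vec k b"]\<close>)
  also have "\<dots> \<le> tensor_cb n T"
    unfolding tensor_cb_def tensor_mat_def[symmetric]
  proof (rule cSup_upper)
    show "bdd_above {op_norm k (tensor_mat n T k U1 U2 U3) |k U1 U2 U3.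
      0 < k \<and> (\<forall>i<n. unitary_k k (U1 i) \<and> unitary_k k (U2 i) \<and> unitary_k k (U3 i))}"
      using op by (intro bdd_aboveI[of _ ?B]) blast
    show "op_norm k (tensor_mat n T k U1 U2 U3) \<in> {op_norm k (tensor_mat n T k U1 U2 U3) |k U1 U2 U3.
      0 < k \<and> (\<forall>i<n. unitary_k k (U1 i) \<and> unitary_k k (U2 i) \<and> unitary_k k (U3 i))}"
      using U ab by fastforce
  qed
  finally show ?thesis .
qed

text \<open>The permutation matrix of the transposition of 0 and \<open>i\<close>, a self-adjoint
  involution.\<close>

definition swap_mat :: "nat \<Rightarrow> nat \<Rightarrow> complex mat" where
  "swap_mat n i = mat n n (\<lambda>(a, b). if a = Transposition.transpose 0 i b then 1 else 0)"

lemma unitary_swap_mat: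
  assumes i: "i < n"
  shows "unitary_k n (swap_mat n i)"
proof -
  have adj: "mat_adjoint (swap_mat n i) = swap_mat n i"
    by (rule eq_matI)
      (auto simp: swap_mat_def mat_adjoint_def mat_of_rows_def transpose_eq_iff)
  have "swap_mat n i * swap_mat n i = 1\<^sub>m n"
  proof (rule eq_matI)
    fix a b assume "a < dim_row (1\<^sub>m n)" "b < dim_col (1\<^sub>m n)"
    then have ab: "a < n" "b < n" by auto
    then have t: "Transposition.transpose 0 i b < n" using i by (auto simp: Transposition.transpose_def)
    have "(swap_mat n i * swap_mat n i) $$ (a, b) = (\<Sum>l<n.
        (if a = Transposition.transpose 0 i l then 1 else 0) * (if l = Transposition.transpose 0 i b then 1 else 0))"
      using ab by (simp add: swap_mat_def scalar_prod_def atLeast0LessThan)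
    also have "\<dots> = (\<Sum>l<n.
        if l = Transposition.transpose 0 i b then if a = Transposition.transpose 0 i l then 1 else 0 else 0)"
      by (intro sum.cong refl) simp
    also have "\<dots> = (if a = b then 1 else 0)"
      using t by simp
    finally show "(swap_mat n i * swap_mat n i) $$ (a, b) = 1\<^sub>m n $$ (a, b)"
      using ab by simp
  qed (auto simp: swap_mat_def)
  then show ?thesis by (auto simp: unitary_k_def adj) (simp add: swap_mat_def)
qed

lemma swap_mat_mult_index:
  assumes U: "U \<in> carrier_mat n n" and il: "i < n" "l < n"
  shows "(swap_mat n i * U * swap_mat n l) $$ (0, 0) = U $$ (i, l)"
proof -
  have n: "0 < n" using il by simp
  have 1: "(swap_mat n i * U) $$ (0, b) = U $$ (i, b)" if "b < n" for b
  proof -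
    have "(swap_mat n i * U) $$ (0, b)
        = (\<Sum>c<n. (if 0 = Transposition.transpose 0 i c then 1 else 0) * U $$ (c, b))"
      using U n that by (simp add: swap_mat_def scalar_prod_def atLeast0LessThan)
    also have "\<dots> = (\<Sum>c<n. if c = i then U $$ (c, b) else 0)"
      by (intro sum.cong refl) (auto simp: Transposition.transpose_def)
    finally have "(swap_mat n i * U) $$ (0, b) = (\<Sum>c<n. if c = i then U $$ (c, b) else 0)" .
    then show ?thesis using il by simp
  qed
  have "(swap_mat n i * U * swap_mat n l) $$ (0, 0)
      = (\<Sum>b<n. (swap_mat n i * U) $$ (0, b) * swap_mat n l $$ (b, 0))"
    using U n by (simp add: scalar_prod_def atLeast0LessThan swap_mat_def del: index_mult_mat(1))
      (simp add: scalar_prod_def atLeast0LessThan)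
  also have "\<dots> = (\<Sum>b<n. if b = l then U $$ (i, b) else 0)"
  proof (intro sum.cong refl)
    fix b assume "b \<in> {..<n}"
    then show "(swap_mat n i * U) $$ (0, b) * swap_mat n l $$ (b, 0) = (if b = l then U $$ (i, b) else 0)"
      using 1[of b] n by (simp add: swap_mat_def[of n l])
  qed
  finally show ?thesis using il by simp
qed

text \<open>
  The transpositions turn the \<open>(0, 0)\<close> entry of \<open>U\<^sub>1(i) U\<^sub>2(j) U\<^sub>3(l)\<close> into the \<open>(i, l)\<close> entry of \<open>U\<^sub>2(j)\<close>.
\<close>

lemma tensor_cb_ge:
  fixes M :: "nat \<Rightarrow> nat \<Rightarrow> nat \<Rightarrow> real"
  assumes n: "0 < n"
    and sym: "\<And>i j l. i < n \<Longrightarrow> j < n \<Longrightarrow> l < n \<Longrightarrow> M j i l = M j l i"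
    and b: "\<And>j y. j < n \<Longrightarrow> L2_set (\<lambda>i. \<Sum>l<n. M j i l * y l) {..<n} \<le> 1/2 * L2_set y {..<n}"
  shows "(\<Sum>i<n. \<Sum>j<n. \<Sum>l<n. T i j l * M j i l) \<le> tensor_cb n T"
proof -
  have "\<forall>j\<in>{..<n}. \<exists>U. unitary_k n U \<and> (\<forall>i<n. \<forall>l<n. Re (U $$ (i, l)) = M j i l)"
  proof
    fix j assume "j \<in> {..<n}"
    then have j: "j < n" by simp
    obtain U where "unitary_k n U" "\<And>i l. i < n \<Longrightarrow> l < n \<Longrightarrow> Re (U $$ (i, l)) = M j i l"
      using exists_unitary_with_Re[of n "M j", OF sym[OF _ j] b[OF j]] by blast
    then show "\<exists>U. unitary_k n U \<and> (\<forall>i<n. \<forall>l<n. Re (U $$ (i, l)) = M j i l)"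
      by blast
  qed
  from bchoice[OF this] obtain U where U: "\<And>j. j < n \<Longrightarrow> unitary_k n (U j)"
    "\<And>i j l. i < n \<Longrightarrow> j < n \<Longrightarrow> l < n \<Longrightarrow> Re (U j $$ (i, l)) = M j i l"
    by blast
  have C: "U j \<in> carrier_mat n n" if "j < n" for j using U(1)[OF that] by (simp add: unitary_k_def)
  have ent: "(swap_mat n i * U j * swap_mat n l) $$ (0, 0) = U j $$ (i, l)" if "i < n" "j < n" "l < n" for i j l
    using C that by (intro swap_mat_mult_index)
  \<comment> \<open>\<open>T\<close> is real, so taking the real part of the sum discards exactly
    the imaginary parts of the unitaries.\<close>
  have "(\<Sum>i<n. \<Sum>j<n. \<Sum>l<n. T i j l * M j i l)
      = Re (\<Sum>i<n. \<Sum>j<n. \<Sum>l<n. complex_of_real (T i j l) * U j $$ (i, l))"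
    by (simp add: U(2))
  also have "(\<Sum>i<n. \<Sum>j<n. \<Sum>l<n. complex_of_real (T i j l) * U j $$ (i, l))
      = tensor_mat n T n (swap_mat n) U (swap_mat n) $$ (0, 0)"
    using n by (simp add: tensor_mat_def ent del: index_mult_mat(1))
  also have "Re \<dots> \<le> cmod (tensor_mat n T n (swap_mat n) U (swap_mat n) $$ (0, 0))"
    by (rule complex_Re_le_cmod)
  also have "\<dots> \<le> tensor_cb n T"
    using n U unitary_swap_mat by (intro cmod_tensor_mat_index_le) auto
  finally show ?thesis .
qed

section \<open>Invariance of the pairing under permutations of the three indices\<close>

lemma permutes3_cases:
  assumes "\<sigma> permutes {0, 1, 2::nat}"
  obtains "\<sigma> 0 = 0" "\<sigma> 1 = 1" "\<sigma> 2 = 2" | "\<sigma> 0 = 0" "\<sigma> 1 = 2" "\<sigma> 2 = 1"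
    | "\<sigma> 0 = 1" "\<sigma> 1 = 0" "\<sigma> 2 = 2" | "\<sigma> 0 = 1" "\<sigma> 1 = 2" "\<sigma> 2 = 0"
    | "\<sigma> 0 = 2" "\<sigma> 1 = 0" "\<sigma> 2 = 1" | "\<sigma> 0 = 2" "\<sigma> 1 = 1" "\<sigma> 2 = 0"
proof -
  have "\<sigma> 0 \<in> {0,1,2}" "\<sigma> 1 \<in> {0,1,2}" "\<sigma> 2 \<in> {0,1,2}"
    using permutes_in_image[OF assms] by simp_all
  moreover have "\<sigma> 0 \<noteq> \<sigma> 1" "\<sigma> 0 \<noteq> \<sigma> 2" "\<sigma> 1 \<noteq> \<sigma> 2"
    using inj_eq[OF permutes_inj[OF assms]] by simp_all
  ultimately show thesis using that by (elim insertE emptyE) simp_all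
qed

text \<open>Exchanging two adjacent summation indices is absorbed by the symmetry of
  \<open>t\<close>; this gives \<open>F1\<close> and \<open>F2\<close>. The two adjacent
  transpositions generate all six permutations, so every case composes these facts.\<close>

lemma sum_tperm_symmetric:
  fixes t T :: tensor3
  assumes t1: "\<And>i j l. t i j l = t j i l" and t2: "\<And>i j l. t i j l = t i l j"
    and \<sigma>: "\<sigma> permutes {0, 1, 2::nat}"
  shows "(\<Sum>i<n. \<Sum>j<n. \<Sum>l<n. tperm \<sigma> T i j l * t i j l) = (\<Sum>i<n. \<Sum>j<n. \<Sum>l<n. T i j l * t i j l)"
proof -
  define F where "F T = (\<Sum>i<n. \<Sum>j<n. \<Sum>l<n. T i j l * t i j l)" for T :: tensor3
  have F1: "F (\<lambda>i j l. T j i l) = F T" for T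
    unfolding F_def by (subst t1) (rule sum.swap)
  have F2: "F (\<lambda>i j l. T i l j) = F T" for T
    unfolding F_def by (subst t2) (intro sum.cong refl sum.swap)
  have "F (tperm \<sigma> T) = F T"
    using \<sigma>
  proof (cases rule: permutes3_cases)
    case 1
    then have "tperm \<sigma> T = T" by (intro ext) (simp add: tperm_def ix3_def)
    then show ?thesis by simp
  next
    case 2
    then have "tperm \<sigma> T = (\<lambda>i j l. T i l j)" by (intro ext) (simp add: tperm_def ix3_def)
    then show ?thesis using F2[of T] by simp
  next
    case 3
    then have "tperm \<sigma> T = (\<lambda>i j l. T j i l)" by (intro ext) (simp add: tperm_def ix3_def)
    then show ?thesis using F1[of T] by simp
  next
    case 4
    then have "tperm \<sigma> T = (\<lambda>i j l. T j l i)" by (intro ext) (simp add: tperm_def ix3_def)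
    then show ?thesis using F1[of "\<lambda>i j l. T i l j"] F2[of T] by simp
  next
    case 5
    then have "tperm \<sigma> T = (\<lambda>i j l. T l i j)" by (intro ext) (simp add: tperm_def ix3_def)
    then show ?thesis using F2[of "\<lambda>i j l. T j i l"] F1[of T] by simp
  next
    case 6
    then have "tperm \<sigma> T = (\<lambda>i j l. T l j i)" by (intro ext) (simp add: tperm_def ix3_def)
    then show ?thesis using F1[of "\<lambda>i j l. T l i j"] F2[of "\<lambda>i j l. T j i l"] F1[of T] by simp
  qed
  then show ?thesis by (simp add: F_def)
qed

text \<open>Duality: \<open>t\<close> is a fixed test tensor. Pairing any admissible decomposition
  with \<open>t\<close> forgets the permutations, and \<open>tensor_cb_ge\<close> bounds each
  summand, so every competitor in the infimum is at least the pairing of \<open>Tp c\<close> with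
  \<open>t\<close>.\<close>

lemma poly_cb_ge:
  fixes t :: tensor3
  assumes n: "0 < n"
    and t1: "\<And>i j l. t i j l = t j i l" and t2: "\<And>i j l. t i j l = t i l j"
    and b: "\<And>i y. i < n \<Longrightarrow> L2_set (\<lambda>j. \<Sum>l<n. t i j l * y l) {..<n} \<le> 1/2 * L2_set y {..<n}"
  shows "(\<Sum>i<n. \<Sum>j<n. \<Sum>l<n. Tp c i j l * t i j l) \<le> poly_cb n c"
  unfolding poly_cb_def
proof (rule cInf_greatest)
  let ?P = "{\<sigma>. \<sigma> permutes {0,1,2::nat}}"
  have fin: "finite ?P" by (simp add: finite_permutations)
  \<comment> \<open>The infimum is over a nonempty set: all of \<open>Tp c\<close> can be placed at
    the identity permutation.\<close>
  have "(\<Sum>\<sigma>\<in>?P. tperm \<sigma> (if \<sigma> = id then Tp c else (\<lambda>_ _ _. 0)) i j l) = Tp c i j l" for i j l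
  proof -
    have "(\<Sum>\<sigma>\<in>?P. tperm \<sigma> (if \<sigma> = id then Tp c else (\<lambda>_ _ _. 0)) i j l)
        = (\<Sum>\<sigma>\<in>?P. if \<sigma> = id then Tp c i j l else 0)"
      by (intro sum.cong) (auto simp: tperm_def ix3_def)
    then show ?thesis using fin by (simp add: permutes_id)
  qed
  then show "{\<Sum>\<sigma>\<in>?P. tensor_cb n (Ts \<sigma>) |Ts. \<forall>i<n. \<forall>j<n. \<forall>l<n.
      Tp c i j l = (\<Sum>\<sigma>\<in>?P. tperm \<sigma> (Ts \<sigma>) i j l)} \<noteq> {}"
    by (auto intro!: exI[of _ "\<lambda>\<sigma>. if \<sigma> = id then Tp c else (\<lambda>_ _ _. 0)"])
  fix s assume "s \<in> {\<Sum>\<sigma>\<in>?P. tensor_cb n (Ts \<sigma>) |Ts. \<forall>i<n. \<forall>j<n. \<forall>l<n.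
      Tp c i j l = (\<Sum>\<sigma>\<in>?P. tperm \<sigma> (Ts \<sigma>) i j l)}"
  then obtain Ts where s: "s = (\<Sum>\<sigma>\<in>?P. tensor_cb n (Ts \<sigma>))"
    and Ts: "\<And>i j l. i < n \<Longrightarrow> j < n \<Longrightarrow> l < n \<Longrightarrow> Tp c i j l = (\<Sum>\<sigma>\<in>?P. tperm \<sigma> (Ts \<sigma>) i j l)"
    by blast
  have "(\<Sum>i<n. \<Sum>j<n. \<Sum>l<n. Tp c i j l * t i j l)
      = (\<Sum>i<n. \<Sum>j<n. \<Sum>l<n. \<Sum>\<sigma>\<in>?P. tperm \<sigma> (Ts \<sigma>) i j l * t i j l)"
    by (intro sum.cong refl) (simp add: Ts sum_distrib_right)
  also have "\<dots> = (\<Sum>i<n. \<Sum>j<n. \<Sum>\<sigma>\<in>?P. \<Sum>l<n. tperm \<sigma> (Ts \<sigma>) i j l * t i j l)"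
    by (intro sum.cong refl sum.swap)
  also have "\<dots> = (\<Sum>i<n. \<Sum>\<sigma>\<in>?P. \<Sum>j<n. \<Sum>l<n. tperm \<sigma> (Ts \<sigma>) i j l * t i j l)"
    by (intro sum.cong refl sum.swap)
  also have "\<dots> = (\<Sum>\<sigma>\<in>?P. \<Sum>i<n. \<Sum>j<n. \<Sum>l<n. tperm \<sigma> (Ts \<sigma>) i j l * t i j l)"
    by (rule sum.swap)
  \<comment> \<open>\<open>tensor_cb_ge\<close> takes the slice number from the middle index of the
    tensor, so the first two arguments of \<open>t\<close> are exchanged to match.\<close>
  also have "\<dots> = (\<Sum>\<sigma>\<in>?P. \<Sum>i<n. \<Sum>j<n. \<Sum>l<n. Ts \<sigma> i j l * t j i l)"
  proof (rule sum.cong[OF refl])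
    fix \<sigma> assume "\<sigma> \<in> ?P"
    then have "(\<Sum>i<n. \<Sum>j<n. \<Sum>l<n. tperm \<sigma> (Ts \<sigma>) i j l * t i j l)
        = (\<Sum>i<n. \<Sum>j<n. \<Sum>l<n. Ts \<sigma> i j l * t i j l)"
      by (intro sum_tperm_symmetric t1 t2) simp
    also have "\<dots> = (\<Sum>i<n. \<Sum>j<n. \<Sum>l<n. Ts \<sigma> i j l * t j i l)"
      by (subst t1) (rule refl)
    finally show "(\<Sum>i<n. \<Sum>j<n. \<Sum>l<n. tperm \<sigma> (Ts \<sigma>) i j l * t i j l)
        = (\<Sum>i<n. \<Sum>j<n. \<Sum>l<n. Ts \<sigma> i j l * t j i l)" .
  qed
  also have "\<dots> \<le> s"
    unfolding s using n t2 b by (intro sum_mono tensor_cb_ge) auto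
  finally show "(\<Sum>i<n. \<Sum>j<n. \<Sum>l<n. Tp c i j l * t i j l) \<le> s" .
qed

section \<open>Concentration of random cubic forms\<close>

text \<open>Hoeffding's inequality: the summands are independent with mean zero and lie in intervals
  of width \<open>2 * \<bar>a \<alpha>\<bar>\<close>. Only an upper bound \<open>V\<close> for the
  sum of squares enters, since the exact sum is awkward to compute in the applications.\<close>

lemma prob_abs_sign_sum_ge:
  fixes a :: "'a \<Rightarrow> real"
  assumes fin: "finite A" and V: "0 < V" "(\<Sum>\<alpha>\<in>A. (a \<alpha>)\<^sup>2) \<le> V" and t: "0 \<le> t"
  shows "measure_pmf.prob (Pi_pmf A 0 (\<lambda>_. pmf_of_set {-1, 1})) {c. t \<le> \<bar>\<Sum>\<alpha>\<in>A. a \<alpha> * c \<alpha>\<bar>}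
    \<le> 2 * exp (- t\<^sup>2 / (2 * V))"
proof -
  define M where "M = Pi_pmf A (0::real) (\<lambda>_. pmf_of_set {-1, 1})"
  have supp: "c \<alpha> \<in> {-1, 1}" if "c \<in> set_pmf M" "\<alpha> \<in> A" for c \<alpha>
    using that fin by (auto simp: M_def set_Pi_pmf PiE_dflt_def)
  have E: "measure_pmf.expectation M (\<lambda>c. a \<alpha> * c \<alpha>) = 0" if "\<alpha> \<in> A" for \<alpha>
  proof -
    have "measure_pmf.expectation M (\<lambda>c. a \<alpha> * c \<alpha>)
        = measure_pmf.expectation (map_pmf (\<lambda>c. c \<alpha>) M) (\<lambda>x. a \<alpha> * x)"
      by simp
    also have "map_pmf (\<lambda>c. c \<alpha>) M = pmf_of_set {-1, 1}"
      using that fin by (simp add: M_def Pi_pmf_component)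
    finally show ?thesis by (simp add: integral_pmf_of_set)
  qed
  define \<mu> where "\<mu> = (\<Sum>\<alpha>\<in>A. measure_pmf.expectation M (\<lambda>c. a \<alpha> * c \<alpha>))"
  interpret Hoeffding_ineq "measure_pmf M" A "\<lambda>\<alpha> c. a \<alpha> * c \<alpha>" "\<lambda>\<alpha>. - \<bar>a \<alpha>\<bar>" "\<lambda>\<alpha>. \<bar>a \<alpha>\<bar>" \<mu>
  proof unfold_locales
    show "prob_space.indep_vars (measure_pmf M) (\<lambda>_. borel) (\<lambda>\<alpha> c. a \<alpha> * c \<alpha>) A"
      using prob_space.indep_vars_compose2[OF measure_pmf.prob_space_axioms
          indep_vars_Pi_pmf[OF fin, of 0 "\<lambda>_. pmf_of_set {-1, 1}"], of "\<lambda>\<alpha> x. a \<alpha> * x" "\<lambda>_. borel"]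
      by (simp add: M_def)
    show "AE c in measure_pmf M. a \<alpha> * c \<alpha> \<in> {- \<bar>a \<alpha>\<bar>..\<bar>a \<alpha>\<bar>}" if "\<alpha> \<in> A" for \<alpha>
      using supp[OF _ that] by (fastforce simp: AE_measure_pmf_iff)
  qed (use fin in \<open>simp_all add: \<mu>_def\<close>)
  have \<mu>0: "\<mu> = 0" unfolding \<mu>_def by (intro sum.neutral) (use E in blast)
  have width: "(\<Sum>\<alpha>\<in>A. (\<bar>a \<alpha>\<bar> - - \<bar>a \<alpha>\<bar>)\<^sup>2) = 4 * (\<Sum>\<alpha>\<in>A. (a \<alpha>)\<^sup>2)"
    by (simp add: power_mult_distrib sum_distrib_left)
  show ?thesis
  \<comment> \<open>The sum of squares is a denominator in Hoeffding's bound. If it vanishes, so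
    does the random sum: the event is empty for positive \<open>t\<close>, and for
    \<open>t = 0\<close> the claimed bound is 2.\<close>
  proof (cases "(\<Sum>\<alpha>\<in>A. (a \<alpha>)\<^sup>2) = 0")
    case True
    then have "a \<alpha> = 0" if "\<alpha> \<in> A" for \<alpha>
      using fin that by (simp add: sum_nonneg_eq_0_iff)
    then have "(\<Sum>\<alpha>\<in>A. a \<alpha> * c \<alpha>) = 0" for c :: "'a \<Rightarrow> real" by simp
    then show ?thesis
      using t by (cases "t = 0") auto
  next
    case False
    then have pos: "0 < (\<Sum>\<alpha>\<in>A. (a \<alpha>)\<^sup>2)"
      using sum_nonneg[of A "\<lambda>\<alpha>. (a \<alpha>)\<^sup>2"] by simp
    have "measure_pmf.prob M {c. t \<le> \<bar>\<Sum>\<alpha>\<in>A. a \<alpha> * c \<alpha>\<bar>} \<le> 2 * exp (-2 * t\<^sup>2 / (4 * (\<Sum>\<alpha>\<in>A. (a \<alpha>)\<^sup>2)))"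
      using Hoeffding_ineq_abs_ge[OF t] pos unfolding width \<mu>0 by simp
    also have "-2 * t\<^sup>2 / (4 * (\<Sum>\<alpha>\<in>A. (a \<alpha>)\<^sup>2)) = - (t\<^sup>2 / (2 * (\<Sum>\<alpha>\<in>A. (a \<alpha>)\<^sup>2)))"
      by simp
    also have "2 * exp \<dots> \<le> 2 * exp (- (t\<^sup>2 / (2 * V)))"
      using pos V t by (simp add: frac_le)
    finally show ?thesis by (simp add: M_def)
  qed
qed

section \<open>Cubic monomials and their index triples\<close>

lemma mono3_in_cubic_monos:
  assumes "i < n" "j < n" "l < n"
  shows "mono3 i j l \<in> cubic_monos n"
proof -
  have "(\<Sum>m<n. mono3 i j l m) = 3"
    using assms by (simp add: mono3_def sum.distrib)
  then show ?thesis
    using assms by (auto simp: cubic_monos_def mono3_def)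
qed

text \<open>Peels one variable off a monomial of degree m + 1. Three applications write a cubic
  monomial as a product of three variables, which yields the count of at most
  \<open>n ^ 3\<close>.\<close>

lemma sum_Suc_decompose:
  fixes \<alpha> :: "nat \<Rightarrow> nat"
  assumes "(\<Sum>i<n. \<alpha> i) = Suc m" "\<And>i. n \<le> i \<Longrightarrow> \<alpha> i = 0"
  obtains i \<beta> where "i < n" "\<And>r. \<alpha> r = (if r = i then 1 else 0) + \<beta> r" "(\<Sum>i<n. \<beta> i) = m"
    "\<And>i. n \<le> i \<Longrightarrow> \<beta> i = 0"
proof -
  obtain i where i: "i < n" "\<alpha> i \<noteq> 0"
    using assms(1) by (metis lessThan_iff nat.distinct(1) sum.neutral)
  define \<beta> where "\<beta> r = (if r = i then \<alpha> i - 1 else \<alpha> r)" for r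
  have eq: "\<alpha> r = (if r = i then 1 else 0) + \<beta> r" for r using i by (simp add: \<beta>_def)
  have "(\<Sum>r<n. \<alpha> r) = (\<Sum>r<n. (if r = i then 1 else 0)) + (\<Sum>r<n. \<beta> r)"
    using eq by (simp only: sum.distrib[symmetric])
  then have "(\<Sum>r<n. \<beta> r) = m" using assms(1) i by simp
  then show thesis
    using i assms(2) by (intro that[OF i(1) eq]) (auto simp: \<beta>_def)
qed

lemma cubic_monos_subset:
  "cubic_monos n \<subseteq> (\<lambda>(i, j, l). mono3 i j l) ` ({..<n} \<times> {..<n} \<times> {..<n})"
proof
  fix \<alpha> assume "\<alpha> \<in> cubic_monos n"
  then have \<alpha>: "(\<Sum>i<n. \<alpha> i) = Suc 2" "\<And>i. n \<le> i \<Longrightarrow> \<alpha> i = 0"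
    by (auto simp: cubic_monos_def)
  obtain i \<beta> where 1: "i < n" "\<And>r. \<alpha> r = (if r = i then 1 else 0) + \<beta> r" "(\<Sum>i<n. \<beta> i) = Suc 1"
    "\<And>i. n \<le> i \<Longrightarrow> \<beta> i = 0"
    using sum_Suc_decompose[OF \<alpha>] by (metis Suc_1)
  obtain j \<gamma> where 2: "j < n" "\<And>r. \<beta> r = (if r = j then 1 else 0) + \<gamma> r" "(\<Sum>i<n. \<gamma> i) = Suc 0"
    "\<And>i. n \<le> i \<Longrightarrow> \<gamma> i = 0"
    using sum_Suc_decompose[OF 1(3,4)] by (metis One_nat_def)
  obtain l \<delta> where 3: "l < n" "\<And>r. \<gamma> r = (if r = l then 1 else 0) + \<delta> r" "(\<Sum>i<n. \<delta> i) = 0"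
    "\<And>i. n \<le> i \<Longrightarrow> \<delta> i = 0"
    using sum_Suc_decompose[OF 2(3,4)] by metis
  have "\<delta> r = 0" for r
    using 3(3,4) by (cases "r < n") auto
  then have "\<alpha> = mono3 i j l"
    using 1(2) 2(2) 3(2) by (auto simp: mono3_def)
  then show "\<alpha> \<in> (\<lambda>(i, j, l). mono3 i j l) ` ({..<n} \<times> {..<n} \<times> {..<n})"
    using 1(1) 2(1) 3(1) by (auto intro!: image_eqI[of _ _ "(i, j, l)"])
qed

lemma finite_cubic_monos: "finite (cubic_monos n)"
  by (rule finite_subset[OF cubic_monos_subset]) auto

lemma card_cubic_monos_le: "card (cubic_monos n) \<le> n ^ 3"
proof -
  have "card (cubic_monos n) \<le> card ((\<lambda>(i, j, l). mono3 i j l) ` ({..<n} \<times> {..<n} \<times> {..<n}))"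
    by (rule card_mono[OF _ cubic_monos_subset]) auto
  also have "\<dots> \<le> card ({..<n} \<times> {..<n} \<times> {..<n})"
    by (rule card_image_le) auto
  finally show ?thesis by (simp add: card_cartesian_product power3_eq_cube)
qed

text \<open>Evaluating both exponent vectors at \<open>j\<close> and then at \<open>l\<close>
  identifies the remaining pair up to order. Hence at most two entries of a slice share a random
  coefficient.\<close>

lemma mono3_eq_iff: "mono3 i j l = mono3 i j' l' \<longleftrightarrow> (j' = j \<and> l' = l) \<or> (j' = l \<and> l' = j)"
proof
  assume h: "mono3 i j l = mono3 i j' l'"
  have eq: "(if m = j then 1 else 0) + (if m = l then 1 else 0)
      = (if m = j' then 1 else 0) + (if m = l' then 1 else (0::nat))" for m
    using fun_cong[OF h, of m] by (simp add: mono3_def)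
  have "j = j' \<or> j = l'"
    using eq[of j] by (rule_tac ccontr) simp
  then show "(j' = j \<and> l' = l) \<or> (j' = l \<and> l' = j)"
  proof
    assume j: "j = j'"
    then have "l = l'" using eq[of l] by (simp split: if_split_asm)
    with j show ?thesis by simp
  next
    assume j: "j = l'"
    then have "l = j'" using eq[of l] by (simp split: if_split_asm)
    with j show ?thesis by simp
  qed
qed (auto simp: mono3_def)

lemma tau3_pos: "0 < tau3 i j l"
  and tau3_le_6: "tau3 i j l \<le> 6"
proof -
  let ?f = "\<lambda>\<sigma>. (ix3 i j l (\<sigma> 0), ix3 i j l (\<sigma> 1), ix3 i j l (\<sigma> 2))"
  have eq: "tau3 i j l = card (?f ` {\<sigma>. \<sigma> permutes {0,1,2::nat}})"
    unfolding tau3_def by (rule arg_cong[where f = card]) blast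
  have fin: "finite {\<sigma>. \<sigma> permutes {0,1,2::nat}}" by (simp add: finite_permutations)
  show "0 < tau3 i j l"
    unfolding eq using fin permutes_id[of "{0,1,2::nat}"] by (subst card_gt_0_iff) blast
  have "card {\<sigma>. \<sigma> permutes {0,1,2::nat}} = fact 3"
    by (rule card_permutations) auto
  then show "tau3 i j l \<le> 6"
    unfolding eq using card_image_le[OF fin, of ?f] by (simp add: fact_numeral)
qed

text \<open>Entries (j, l) and (l, j) of a slice carry the same coefficient, so the form is first
  regrouped by monomials into independent terms. Each group has at most two members, so
  Cauchy-Schwarz costs a factor 2; with \<open>tau3\<close> at least 1 the sum of squares is at most
  2, and Hoeffding applies with \<open>V = 2\<close>.\<close>

lemma prob_slice_form_ge:
  assumes i: "i < n" and y: "L2_set y {..<n} \<le> 1" and z: "L2_set z {..<n} \<le> 1" and t: "0 \<le> t"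
  shows "measure_pmf.prob (sign_coeffs n) {c. t \<le> \<bar>\<Sum>j<n. \<Sum>l<n. Tp c i j l * (y j * z l)\<bar>}
    \<le> 2 * exp (- t\<^sup>2 / 4)"
proof -
  let ?X = "{..<n} \<times> {..<n}"
  define g where "g = (\<lambda>(j, l). mono3 i j l)"
  define h where "h = (\<lambda>(j, l). y j * z l / real (tau3 i j l))"
  define a where "a \<alpha> = sum h {x \<in> ?X. g x = \<alpha>}" for \<alpha>
  have g: "g ` ?X \<subseteq> cubic_monos n"
    using i by (auto simp: g_def intro: mono3_in_cubic_monos)
  have lin: "(\<Sum>j<n. \<Sum>l<n. Tp c i j l * (y j * z l)) = (\<Sum>\<alpha>\<in>cubic_monos n. a \<alpha> * c \<alpha>)" for c
  proof -
    have "(\<Sum>j<n. \<Sum>l<n. Tp c i j l * (y j * z l)) = (\<Sum>x\<in>?X. h x * c (g x))"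
      unfolding sum.cartesian_product
      by (intro sum.cong refl) (simp add: Tp_def h_def g_def case_prod_unfold)
    also have "\<dots> = (\<Sum>\<alpha>\<in>cubic_monos n. \<Sum>x\<in>{x \<in> ?X. g x = \<alpha>}. h x * c (g x))"
      by (rule sum.group[symmetric]) (use g finite_cubic_monos in auto)
    also have "\<dots> = (\<Sum>\<alpha>\<in>cubic_monos n. a \<alpha> * c \<alpha>)"
      unfolding a_def sum_distrib_right by (intro sum.cong) auto
    finally show ?thesis .
  qed
  have fiber: "(a \<alpha>)\<^sup>2 \<le> (\<Sum>x\<in>{x \<in> ?X. g x = \<alpha>}. 2 * (h x)\<^sup>2)" for \<alpha>
  proof -
    let ?F = "{x \<in> ?X. g x = \<alpha>}"
    have "card ?F \<le> 2"
    proof (cases "?F = {}")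
      case False
      then obtain j l where "(j, l) \<in> ?F" by auto
      then have "?F \<subseteq> {(j, l), (l, j)}"
        by (auto simp: g_def mono3_eq_iff)
      then have "card ?F \<le> card {(j, l), (l, j)}" by (intro card_mono) auto
      also have "\<dots> \<le> 2" by (cases "j = l") simp_all
      finally show ?thesis .
    qed (simp only: card.empty zero_le)
    moreover have "(a \<alpha>)\<^sup>2 \<le> (\<Sum>x\<in>?F. (h x)\<^sup>2) * card ?F"
      unfolding a_def by (rule sum_squared_le_sum_of_squares)
    ultimately have "(a \<alpha>)\<^sup>2 \<le> (\<Sum>x\<in>?F. (h x)\<^sup>2) * 2"
      by (elim order_trans) (intro mult_left_mono sum_nonneg, simp_all)
    then show ?thesis by (simp add: sum_distrib_left mult.commute)
  qed
  have "(\<Sum>\<alpha>\<in>cubic_monos n. (a \<alpha>)\<^sup>2) \<le> (\<Sum>\<alpha>\<in>cubic_monos n. \<Sum>x\<in>{x \<in> ?X. g x = \<alpha>}. 2 * (h x)\<^sup>2)"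
    by (rule sum_mono) (rule fiber)
  also have "\<dots> = (\<Sum>x\<in>?X. 2 * (h x)\<^sup>2)"
    by (rule sum.group) (use g finite_cubic_monos in auto)
  also have "\<dots> \<le> (\<Sum>x\<in>?X. 2 * ((y (fst x))\<^sup>2 * (z (snd x))\<^sup>2))"
  proof (rule sum_mono)
    fix x
    have "1 \<le> (real (tau3 i (fst x) (snd x)))\<^sup>2"
      using tau3_pos[of i "fst x" "snd x"] by simp
    then have "(y (fst x) * z (snd x))\<^sup>2 / (real (tau3 i (fst x) (snd x)))\<^sup>2 \<le> (y (fst x) * z (snd x))\<^sup>2 / 1"
      by (intro divide_left_mono) (simp_all add: tau3_pos)
    then show "2 * (h x)\<^sup>2 \<le> 2 * ((y (fst x))\<^sup>2 * (z (snd x))\<^sup>2)"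
      by (simp add: h_def case_prod_unfold power_divide power_mult_distrib)
  qed
  also have "\<dots> = 2 * ((\<Sum>j<n. (y j)\<^sup>2) * (\<Sum>l<n. (z l)\<^sup>2))"
    unfolding sum_product sum.cartesian_product by (simp add: case_prod_unfold sum_distrib_left)
  also have "\<dots> \<le> 2 * (1 * 1)"
    using y z by (intro mult_left_mono mult_mono) (auto simp: L2_set_def sum_nonneg)
  finally have V: "(\<Sum>\<alpha>\<in>cubic_monos n. (a \<alpha>)\<^sup>2) \<le> 2" by simp
  show ?thesis
    using prob_abs_sign_sum_ge[OF finite_cubic_monos _ V t] by (simp add: lin sign_coeffs_def)
qed

text \<open>At a sign vector every monomial is 1 or -1, so the sum of squares is the number of
  monomials, at most \<open>n ^ 3\<close>.\<close>

lemma prob_peval_ge: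
  assumes n: "0 < n" and x: "x \<in> PiE {..<n} (\<lambda>_. {-1, 1})" and t: "0 \<le> t"
  shows "measure_pmf.prob (sign_coeffs n) {c. t \<le> \<bar>peval n c x\<bar>} \<le> 2 * exp (- t\<^sup>2 / (2 * real n ^ 3))"
proof -
  have "(x i ^ k)\<^sup>2 = 1" if "i < n" for i k
  proof -
    have "x i \<in> {-1, 1}" using x that by auto
    then have "(x i)\<^sup>2 = 1" by auto
    moreover have "(x i ^ k)\<^sup>2 = ((x i)\<^sup>2) ^ k"
      by (simp add: mult.commute flip: power_mult)
    ultimately show ?thesis by simp
  qed
  then have "(\<Prod>i<n. x i ^ \<alpha> i)\<^sup>2 = 1" for \<alpha>
    unfolding prod_power_distrib by (intro prod.neutral) simp
  then have "(\<Sum>\<alpha>\<in>cubic_monos n. (\<Prod>i<n. x i ^ \<alpha> i)\<^sup>2) = real (card (cubic_monos n))"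
    by simp
  also have "\<dots> \<le> real n ^ 3"
    using card_cubic_monos_le[of n] by (metis of_nat_le_iff of_nat_power)
  finally show ?thesis
    using prob_abs_sign_sum_ge[OF finite_cubic_monos _ _ t, of "real n ^ 3" "\<lambda>\<alpha>. \<Prod>i<n. x i ^ \<alpha> i"] n
    by (simp add: peval_def sign_coeffs_def mult.commute)
qed

section \<open>A net of the Euclidean ball\<close>

text \<open>Integer points of the ball of radius 4 sqrt(n); \<open>grid_point\<close> scales them
  into the unit ball. The spacing 1 / (4 sqrt(n)) makes a coordinatewise rounding error at most 1/4
  in Euclidean norm. The box exhibits the set inside a finite product.\<close>

definition grid :: "nat \<Rightarrow> (nat \<Rightarrow> int) set" where
  "grid n = {z \<in> PiE {..<n} (\<lambda>_. {- int (16 * n)..int (16 * n)}). (\<Sum>i<n. (z i)\<^sup>2) \<le> int (16 * n)}"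

definition grid_point :: "nat \<Rightarrow> (nat \<Rightarrow> int) \<Rightarrow> nat \<Rightarrow> real" where
  "grid_point n z i = real_of_int (z i) / (4 * sqrt (real n))"

lemma finite_grid: "finite (grid n)"
  unfolding grid_def by (intro finite_Collect_conjI disjI1) (auto intro!: finite_PiE)

lemma sum_half_powers: "(\<Sum>k\<in>{- int m..int m}. (1/2) ^ nat \<bar>k\<bar>) = 3 - 2 * (1/2 :: real) ^ m"
proof (induction m)
  case (Suc m)
  have "{- int (Suc m)..int (Suc m)} = insert (- int (Suc m)) (insert (int (Suc m)) {- int m..int m})"
    by auto
  then have "(\<Sum>k\<in>{- int (Suc m)..int (Suc m)}. (1/2) ^ nat \<bar>k\<bar>)
      = (1/2) ^ Suc m + ((1/2) ^ Suc m + (\<Sum>k\<in>{- int m..int m}. (1/2 :: real) ^ nat \<bar>k\<bar>))"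
    by (simp add: nat_add_distrib)
  then show ?case using Suc by simp
qed simp

lemma abs_le_power2_int: "\<bar>k\<bar> \<le> (k::int)\<^sup>2"
proof (cases "k = 0")
  case False
  then have "\<bar>k\<bar> * 1 \<le> \<bar>k\<bar> * \<bar>k\<bar>" by (intro mult_left_mono) auto
  then show ?thesis by (simp add: power2_eq_square)
qed simp

text \<open>
  Since \<open>\<Sum>\<bar>z\<^sub>i\<bar> \<le> \<Sum>z\<^sub>i\<^sup>2 \<le> 16 n\<close>, weighting \<open>z\<close> by \<open>2 ^ (16 n - \<Sum>\<bar>z\<^sub>i\<bar>) \<ge> 1\<close> bounds the count by a product of geometric sums.
\<close>

lemma card_grid_le: "real (card (grid n)) \<le> 2 ^ (18 * n)"
proof -
  let ?B = "PiE {..<n} (\<lambda>_. {- int (16 * n)..int (16 * n)})"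
  have w: "1 \<le> 2 ^ (16 * n) * (\<Prod>i<n. (1/2 :: real) ^ nat \<bar>z i\<bar>)" if "z \<in> grid n" for z
  proof -
    have "(\<Sum>i<n. \<bar>z i\<bar>) \<le> (\<Sum>i<n. (z i)\<^sup>2)"
      by (intro sum_mono abs_le_power2_int)
    also have "\<dots> \<le> int (16 * n)" using that by (simp add: grid_def)
    finally have "(\<Sum>i<n. int (nat \<bar>z i\<bar>)) \<le> int (16 * n)" by simp
    then have "(\<Sum>i<n. nat \<bar>z i\<bar>) \<le> 16 * n"
      by (simp only: of_nat_sum[symmetric] of_nat_le_iff)
    then have "(1/2 :: real) ^ (16 * n) \<le> (1/2) ^ (\<Sum>i<n. nat \<bar>z i\<bar>)"
      by (intro power_decreasing) auto
    then have "2 ^ (16 * n) * (1/2 :: real) ^ (16 * n) \<le> 2 ^ (16 * n) * (\<Prod>i<n. (1/2 :: real) ^ nat \<bar>z i\<bar>)"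
      by (intro mult_left_mono) (auto simp: power_sum)
    then show ?thesis by (simp add: power_divide)
  qed
  have "real (card (grid n)) = (\<Sum>z\<in>grid n. 1)" by simp
  also have "\<dots> \<le> (\<Sum>z\<in>grid n. 2 ^ (16 * n) * (\<Prod>i<n. (1/2 :: real) ^ nat \<bar>z i\<bar>))"
    by (intro sum_mono w)
  also have "\<dots> \<le> (\<Sum>z\<in>?B. 2 ^ (16 * n) * (\<Prod>i<n. (1/2 :: real) ^ nat \<bar>z i\<bar>))"
  proof (intro sum_mono2)
    show "finite ?B" by (intro finite_PiE) auto
    show "grid n \<subseteq> ?B" unfolding grid_def by blast
  qed (simp add: prod_nonneg)
  also have "\<dots> = 2 ^ (16 * n) * (\<Prod>i<n. \<Sum>k\<in>{- int (16 * n)..int (16 * n)}. (1/2 :: real) ^ nat \<bar>k\<bar>)"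
    by (subst prod_sum_PiE) (simp_all add: sum_distrib_left)
  \<comment> \<open>Each geometric sum is at most 3; rounding up to 4 keeps everything a power of
    two.\<close>
  also have "\<dots> \<le> 2 ^ (16 * n) * (\<Prod>i<n. 4)"
  proof (intro mult_left_mono prod_mono)
    have "(1/2 :: real) ^ (16 * n) \<le> 1" "0 \<le> (1/2 :: real) ^ (16 * n)"
      by (simp_all add: power_le_one)
    then show "0 \<le> (\<Sum>k\<in>{- int (16 * n)..int (16 * n)}. (1/2 :: real) ^ nat \<bar>k\<bar>) \<and>
        (\<Sum>k\<in>{- int (16 * n)..int (16 * n)}. (1/2 :: real) ^ nat \<bar>k\<bar>) \<le> 4"
      unfolding sum_half_powers by linarith
  qed simp
  also have "\<dots> = 2 ^ (16 * n) * (2\<^sup>2) ^ n" by simp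
  also have "\<dots> = 2 ^ (18 * n)"
    by (simp only: power_mult[symmetric] power_add[symmetric]) simp
  finally show ?thesis .
qed

lemma L2_set_grid_point_le_1:
  assumes "0 < n" "z \<in> grid n"
  shows "L2_set (grid_point n z) {..<n} \<le> 1"
proof -
  have "(\<Sum>i<n. (grid_point n z i)\<^sup>2) = (\<Sum>i<n. (real_of_int (z i))\<^sup>2) / (16 * real n)"
    by (simp add: grid_point_def power_divide power_mult_distrib sum_divide_distrib)
  also have "(\<Sum>i<n. (real_of_int (z i))\<^sup>2) = real_of_int (\<Sum>i<n. (z i)\<^sup>2)" by simp
  also have "\<dots> \<le> 16 * real n"
    using assms by (simp only: grid_def mem_Collect_eq) linarith
  finally have "(\<Sum>i<n. (grid_point n z i)\<^sup>2) \<le> 1"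
    using assms by (simp add: divide_right_mono)
  then show ?thesis by (simp add: L2_set_def)
qed

lemma exists_grid_point_near:
  assumes n: "0 < n" and x: "L2_set x {..<n} \<le> 1"
  obtains z where "z \<in> grid n" "L2_set (\<lambda>i. x i - grid_point n z i) {..<n} \<le> 1/4"
proof -
  define s where "s = 4 * sqrt (real n)"
  have s: "0 < s" "s\<^sup>2 = 16 * real n" using n by (auto simp: s_def power_mult_distrib)
  \<comment> \<open>Rounding towards zero: it moves each coordinate of \<open>s * x\<close> by at
    most 1 and never increases its modulus, so the rounded point stays in the ball required by
    \<open>grid\<close>.\<close>
  define z where "z = (\<lambda>i\<in>{..<n}. if 0 \<le> x i then \<lfloor>s * x i\<rfloor> else \<lceil>s * x i\<rceil>)"
  have near: "\<bar>s * x i - real_of_int (z i)\<bar> \<le> 1" and le: "\<bar>real_of_int (z i)\<bar> \<le> \<bar>s * x i\<bar>" if "i < n" for i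
  proof -
    have "0 \<le> s * x i" if "0 \<le> x i" using that s by simp
    moreover have "s * x i \<le> 0" if "\<not> 0 \<le> x i" using that s by (simp add: mult_le_0_iff)
    ultimately show "\<bar>s * x i - real_of_int (z i)\<bar> \<le> 1" "\<bar>real_of_int (z i)\<bar> \<le> \<bar>s * x i\<bar>"
      using \<open>i < n\<close> unfolding z_def by (auto; linarith)+
  qed
  have x2: "(\<Sum>i<n. (x i)\<^sup>2) \<le> 1" using x by (simp add: L2_set_def)
  have "real_of_int (\<Sum>i<n. (z i)\<^sup>2) \<le> (\<Sum>i<n. (s * x i)\<^sup>2)"
    using le by (auto simp: abs_le_square_iff intro!: sum_mono)
  also have "\<dots> = s\<^sup>2 * (\<Sum>i<n. (x i)\<^sup>2)" by (simp add: power_mult_distrib sum_distrib_left)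
  also have "\<dots> \<le> s\<^sup>2 * 1" using x2 by (intro mult_left_mono) auto
  finally have sq: "(\<Sum>i<n. (z i)\<^sup>2) \<le> int (16 * n)" unfolding s(2) by linarith
  have "z i \<in> {- int (16 * n)..int (16 * n)}" if "i < n" for i
  proof -
    have "\<bar>z i\<bar> \<le> (z i)\<^sup>2"
      by (rule abs_le_power2_int)
    also have "\<dots> \<le> (\<Sum>i<n. (z i)\<^sup>2)"
      using that by (intro member_le_sum) auto
    finally show ?thesis using sq by auto
  qed
  then have "z \<in> grid n" using sq by (auto simp: grid_def z_def)
  moreover have "L2_set (\<lambda>i. x i - grid_point n z i) {..<n} \<le> 1/4"
  proof -
    have "(x i - grid_point n z i)\<^sup>2 \<le> 1 / s\<^sup>2" if "i < n" for i
    proof -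
      have "x i - grid_point n z i = (s * x i - real_of_int (z i)) / s"
        using s(1) unfolding grid_point_def s_def[symmetric] by (simp add: field_simps)
      moreover have "(s * x i - real_of_int (z i))\<^sup>2 \<le> 1"
        using near[OF that] by (simp add: abs_square_le_1)
      ultimately show ?thesis using s(1) by (simp add: power_divide divide_right_mono)
    qed
    then have "(\<Sum>i<n. (x i - grid_point n z i)\<^sup>2) \<le> (\<Sum>i<n. 1 / s\<^sup>2)" by (intro sum_mono) auto
    also have "\<dots> = (1/4)\<^sup>2" using n unfolding s(2) by (simp add: power2_eq_square)
    finally have "sqrt (\<Sum>i<n. (x i - grid_point n z i)\<^sup>2) \<le> sqrt ((1/4)\<^sup>2)"
      by (rule real_sqrt_le_mono)
    then show ?thesis by (simp add: L2_set_def)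
  qed
  ultimately show thesis by (rule that)
qed

text \<open>Let S be the supremum over the unit ball. Moving each argument to a net point within 1/4
  costs at most S/4 by homogeneity, so S \<le> K + S/2. Since S is finite, by the sum of the moduli
  of the entries, it can be absorbed.\<close>

lemma bilinear_bound_from_grid:
  fixes A :: "nat \<Rightarrow> nat \<Rightarrow> real"
  assumes n: "0 < n"
    and K: "\<And>z w. z \<in> grid n \<Longrightarrow> w \<in> grid n \<Longrightarrow>
      \<bar>\<Sum>j<n. \<Sum>l<n. A j l * (grid_point n z j * grid_point n w l)\<bar> \<le> K"
    and x: "L2_set x {..<n} \<le> 1" and y: "L2_set y {..<n} \<le> 1"
  shows "\<bar>\<Sum>j<n. \<Sum>l<n. A j l * (x j * y l)\<bar> \<le> 2 * K"
proof -
  define B where "B x y = (\<Sum>j<n. \<Sum>l<n. A j l * (x j * y l))" for x y :: "nat \<Rightarrow> real"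
  define U where "U = {x :: nat \<Rightarrow> real. L2_set x {..<n} \<le> 1}"
  define S where "S = (SUP (x, y)\<in>U \<times> U. \<bar>B x y\<bar>)"
  have "\<bar>B x y\<bar> \<le> (\<Sum>j<n. \<Sum>l<n. \<bar>A j l\<bar>)" if "x \<in> U" "y \<in> U" for x y
  proof -
    have c: "\<bar>v i\<bar> \<le> 1" if "v \<in> U" "i < n" for v :: "nat \<Rightarrow> real" and i
    proof -
      have "\<bar>v i\<bar> \<le> L2_set (\<lambda>i. \<bar>v i\<bar>) {..<n}"
        using that by (intro member_le_L2_set) auto
      also have "\<dots> = L2_set v {..<n}" by (simp add: L2_set_def)
      finally show ?thesis using that by (simp add: U_def)
    qed
    have "\<bar>A j l * (x j * y l)\<bar> \<le> \<bar>A j l\<bar>" if "j < n" "l < n" for j l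
    proof -
      have "\<bar>x j\<bar> * \<bar>y l\<bar> \<le> 1" using c \<open>x \<in> U\<close> \<open>y \<in> U\<close> that by (intro mult_le_one) auto
      then show ?thesis by (simp add: abs_mult mult_left_le)
    qed
    then show ?thesis
      unfolding B_def by (intro order_trans[OF sum_abs] sum_mono) auto
  qed
  then have bdd: "bdd_above ((\<lambda>(x, y). \<bar>B x y\<bar>) ` (U \<times> U))"
    by (intro bdd_aboveI) auto
  have upper: "\<bar>B x y\<bar> \<le> S" if "x \<in> U" "y \<in> U" for x y
    unfolding S_def by (rule cSUP_upper2[OF bdd, of "(x, y)"]) (use that in auto)
  have scale: "(\<lambda>i. 4 * d i) \<in> U" if "L2_set d {..<n} \<le> 1/4" for d
    using that by (simp add: U_def flip: L2_set_right_distrib)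
  have left: "\<bar>B d y\<bar> \<le> S / 4" if "L2_set d {..<n} \<le> 1/4" "y \<in> U" for d y
  proof -
    have "B (\<lambda>i. 4 * d i) y = 4 * B d y" by (simp add: B_def sum_distrib_left mult_ac)
    then show ?thesis using upper[OF scale[OF that(1)] that(2)] by (simp add: abs_mult)
  qed
  have right: "\<bar>B y d\<bar> \<le> S / 4" if "L2_set d {..<n} \<le> 1/4" "y \<in> U" for d y
  proof -
    have "B y (\<lambda>i. 4 * d i) = 4 * B y d" by (simp add: B_def sum_distrib_left mult_ac)
    then show ?thesis using upper[OF that(2) scale[OF that(1)]] by (simp add: abs_mult)
  qed
  have B_diff: "B x (\<lambda>i. y i - w i) = B x y - B x w" "B (\<lambda>i. y i - w i) x = B y x - B w x" for x y w
    by (simp_all add: B_def algebra_simps sum_subtractf)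
  have "\<bar>B x y\<bar> \<le> K + S / 2" if xy: "x \<in> U" "y \<in> U" for x y
  proof -
    obtain z where z: "z \<in> grid n" "L2_set (\<lambda>i. x i - grid_point n z i) {..<n} \<le> 1/4"
      using exists_grid_point_near[OF n, of x] xy by (auto simp: U_def)
    obtain w where w: "w \<in> grid n" "L2_set (\<lambda>i. y i - grid_point n w i) {..<n} \<le> 1/4"
      using exists_grid_point_near[OF n, of y] xy by (auto simp: U_def)
    have "B x y = B (grid_point n z) (grid_point n w) + B (grid_point n z) (\<lambda>i. y i - grid_point n w i)
        + B (\<lambda>i. x i - grid_point n z i) y"
      by (simp add: B_diff)
    moreover have "\<bar>B (grid_point n z) (grid_point n w)\<bar> \<le> K"
      using K[OF z(1) w(1)] by (simp add: B_def)
    moreover have "\<bar>B (grid_point n z) (\<lambda>i. y i - grid_point n w i)\<bar> \<le> S / 4"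
      using right[OF w(2)] L2_set_grid_point_le_1[OF n z(1)] by (simp add: U_def)
    moreover have "\<bar>B (\<lambda>i. x i - grid_point n z i) y\<bar> \<le> S / 4"
      using left[OF z(2) xy(2)] .
    ultimately show ?thesis by linarith
  qed
  moreover have "U \<times> U \<noteq> {}" by (auto simp: U_def L2_set_def intro!: exI[of _ "\<lambda>_. 0"])
  ultimately have "S \<le> K + S / 2"
    unfolding S_def by (intro cSUP_least) auto
  then show ?thesis
    using upper[of x y] x y by (simp add: U_def B_def)
qed

text \<open>Test the form on the normalised vectors Ay and y, where its value is the quotient of
  their norms. If either norm is zero, the left-hand side vanishes.\<close>

lemma L2_set_bound_from_bilinear:
  fixes A :: "nat \<Rightarrow> nat \<Rightarrow> real"
  assumes C: "\<And>x y. L2_set x {..<n} \<le> 1 \<Longrightarrow> L2_set y {..<n} \<le> 1 \<Longrightarrow>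
      \<bar>\<Sum>j<n. \<Sum>l<n. A j l * (x j * y l)\<bar> \<le> C"
  shows "L2_set (\<lambda>j. \<Sum>l<n. A j l * y l) {..<n} \<le> C * L2_set y {..<n}"
proof -
  define v where "v j = (\<Sum>l<n. A j l * y l)" for j
  define a where "a = L2_set v {..<n}"
  define b where "b = L2_set y {..<n}"
  show ?thesis
  proof (cases "a = 0 \<or> b = 0")
    case True
    have "a = 0" if "b = 0"
      using that by (auto simp: a_def b_def v_def L2_set_eq_0_iff)
    with True have "a = 0" by blast
    moreover have "0 \<le> C" using C[of "\<lambda>_. 0" "\<lambda>_. 0"] by (simp add: L2_set_def)
    ultimately show ?thesis by (simp add: a_def v_def[abs_def])
  next
    case False
    then have ab: "0 < a" "0 < b"
      using L2_set_nonneg[of v "{..<n}"] L2_set_nonneg[of y "{..<n}"] unfolding a_def b_def by linarith+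
    have "L2_set (\<lambda>j. v j * (1 / a)) {..<n} = 1" "L2_set (\<lambda>l. y l * (1 / b)) {..<n} = 1"
      using ab L2_set_left_distrib[of "1 / a" v "{..<n}"] L2_set_left_distrib[of "1 / b" y "{..<n}"]
      unfolding a_def[symmetric] b_def[symmetric] by simp_all
    then have "\<bar>\<Sum>j<n. \<Sum>l<n. A j l * (v j * (1 / a) * (y l * (1 / b)))\<bar> \<le> C"
      by (intro C) auto
    also have "(\<Sum>j<n. \<Sum>l<n. A j l * (v j * (1 / a) * (y l * (1 / b)))) = (\<Sum>j<n. v j * v j) / (a * b)"
      unfolding sum_divide_distrib
      by (intro sum.cong refl, subst (3) v_def)
        (simp add: sum_distrib_left sum_divide_distrib mult_ac)
    also have "(\<Sum>j<n. v j * v j) = a * a"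
      by (simp add: a_def L2_set_def sum_nonneg power2_eq_square)
    finally have "a / b \<le> C" using ab by simp
    then show ?thesis using ab by (simp add: a_def b_def v_def[abs_def] field_simps)
  qed
qed

section \<open>Comparison of the two norms\<close>

text \<open>Composing with \<open>\<pi>\<close> shows that every rearrangement of the permuted
  triple is one of the original triple. One inequality suffices: for a transposition the converse is
  another instance.\<close>

lemma tau3_le_permuted:
  assumes \<pi>: "\<pi> permutes {0, 1, 2::nat}"
    and ix: "\<And>m. m \<in> {0, 1, 2} \<Longrightarrow> ix3 i' j' l' m = ix3 i j l (\<pi> m)"
  shows "tau3 i' j' l' \<le> tau3 i j l"
  unfolding tau3_def
proof (rule card_mono)
  let ?S = "\<lambda>i j l. {(ix3 i j l (\<sigma> 0), ix3 i j l (\<sigma> 1), ix3 i j l (\<sigma> 2)) | \<sigma>. \<sigma> permutes {0,1,2::nat}}"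
  have "?S i j l = (\<lambda>\<sigma>. (ix3 i j l (\<sigma> 0), ix3 i j l (\<sigma> 1), ix3 i j l (\<sigma> 2))) ` {\<sigma>. \<sigma> permutes {0,1,2}}"
    by blast
  then show "finite (?S i j l)" by (simp add: finite_permutations)
  show "?S i' j' l' \<subseteq> ?S i j l"
  proof
    fix p assume "p \<in> ?S i' j' l'"
    then obtain \<sigma> where \<sigma>: "\<sigma> permutes {0,1,2::nat}"
      and p: "p = (ix3 i' j' l' (\<sigma> 0), ix3 i' j' l' (\<sigma> 1), ix3 i' j' l' (\<sigma> 2))" by blast
    have e: "ix3 i' j' l' (\<sigma> m) = ix3 i j l (\<pi> (\<sigma> m))" if "m \<in> {0,1,2}" for m
      using that by (intro ix) (simp only: permutes_in_image[OF \<sigma>])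
    have "p = (ix3 i j l ((\<pi> \<circ> \<sigma>) 0), ix3 i j l ((\<pi> \<circ> \<sigma>) 1), ix3 i j l ((\<pi> \<circ> \<sigma>) 2))"
      unfolding p using e[of 0] e[of 1] e[of 2] by simp
    with permutes_compose[OF \<sigma> \<pi>] show "p \<in> ?S i j l"
      unfolding mem_Collect_eq by (intro exI conjI)
  qed
qed

lemma Tp_swap12: "Tp c i j l = Tp c j i l"
proof -
  have le: "tau3 i j l \<le> tau3 j i l" for i j l
    by (rule tau3_le_permuted[of "Transposition.transpose 0 1"])
      (auto intro!: permutes_swap_id simp: ix3_def)
  have "tau3 i j l = tau3 j i l" by (rule antisym[OF le le])
  moreover have "mono3 i j l = mono3 j i l" by (auto simp: mono3_def)
  ultimately show ?thesis by (simp add: Tp_def)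
qed

lemma Tp_swap23: "Tp c i j l = Tp c i l j"
proof -
  have le: "tau3 i j l \<le> tau3 i l j" for i j l
    by (rule tau3_le_permuted[of "Transposition.transpose 1 2"])
      (auto intro!: permutes_swap_id simp: ix3_def Transposition.transpose_def)
  have "tau3 i j l = tau3 i l j" by (rule antisym[OF le le])
  moreover have "mono3 i j l = mono3 i l j" by (auto simp: mono3_def)
  ultimately show ?thesis by (simp add: Tp_def)
qed

lemma poly_cb_lower_bound:
  assumes n: "0 < n"
    and c: "\<And>\<alpha>. \<alpha> \<in> cubic_monos n \<Longrightarrow> c \<alpha> \<in> {-1, 1}"
    and small: "\<And>i z w. i < n \<Longrightarrow> z \<in> grid n \<Longrightarrow> w \<in> grid n \<Longrightarrow>
      \<bar>\<Sum>j<n. \<Sum>l<n. Tp c i j l * (grid_point n z j * grid_point n w l)\<bar> \<le> 13 * sqrt (real n)"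
  shows "real n ^ 3 / (1872 * sqrt (real n)) \<le> poly_cb n c"
proof -
  \<comment> \<open>The net bound \<open>13 * sqrt n\<close> doubles to \<open>26 * sqrt n\<close>
    for the whole slice, which is \<open>s / 2\<close>; so the test tensor
    \<open>Tp c i j l / s\<close> has slices of norm at most 1/2.\<close>
  define s where "s = 52 * sqrt (real n)"
  have s: "0 < s" using n by (simp add: s_def)
  have Tp2: "1 / 36 \<le> (Tp c i j l)\<^sup>2" if "i < n" "j < n" "l < n" for i j l
  proof -
    have "(c (mono3 i j l))\<^sup>2 = 1" using c[OF mono3_in_cubic_monos[OF that]] by auto
    moreover have "(real (tau3 i j l))\<^sup>2 \<le> 6\<^sup>2"
      using tau3_le_6[of i j l] by (intro power_mono) auto
    moreover have "0 < (real (tau3 i j l))\<^sup>2" using tau3_pos[of i j l] by simp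
    ultimately show ?thesis by (simp add: Tp_def power_divide field_simps)
  qed
  \<comment> \<open>1872 = 36 * 52, where 1/36 bounds the squared entries from below because the
    coefficients are signs and \<open>tau3\<close> is at most 6.\<close>
  have "real n ^ 3 / (1872 * sqrt (real n)) = (\<Sum>i<n. \<Sum>j<n. \<Sum>l<n. 1 / 36 / s)"
    by (simp add: s_def power3_eq_cube)
  also have "\<dots> \<le> (\<Sum>i<n. \<Sum>j<n. \<Sum>l<n. Tp c i j l * (Tp c i j l / s))"
  proof (intro sum_mono)
    fix i j l assume "i \<in> {..<n}" "j \<in> {..<n}" "l \<in> {..<n}"
    then have "1 / 36 / s \<le> (Tp c i j l)\<^sup>2 / s"
      using Tp2 s by (intro divide_right_mono) auto
    then show "1 / 36 / s \<le> Tp c i j l * (Tp c i j l / s)" by (simp add: power2_eq_square)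
  qed
  also have "\<dots> \<le> poly_cb n c"
  proof (rule poly_cb_ge[OF n])
    show "Tp c i j l / s = Tp c j i l / s" for i j l by (subst Tp_swap12) (rule refl)
    show "Tp c i j l / s = Tp c i l j / s" for i j l by (subst Tp_swap23) (rule refl)
    fix i y assume i: "i < n"
    have "L2_set (\<lambda>j. \<Sum>l<n. Tp c i j l * y l) {..<n} \<le> 2 * (13 * sqrt (real n)) * L2_set y {..<n}"
      by (rule L2_set_bound_from_bilinear, rule bilinear_bound_from_grid[OF n small[OF i]])
    then have "L2_set (\<lambda>j. \<Sum>l<n. Tp c i j l * y l) {..<n} * (1 / s) \<le> s / 2 * L2_set y {..<n} * (1 / s)"
      using s by (intro mult_right_mono) (auto simp: s_def)
    also have "\<dots> = 1/2 * L2_set y {..<n}" using s by simp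
    also have "L2_set (\<lambda>j. \<Sum>l<n. Tp c i j l * y l) {..<n} * (1 / s)
        = L2_set (\<lambda>j. (\<Sum>l<n. Tp c i j l * y l) * (1 / s)) {..<n}"
      using s by (intro L2_set_left_distrib) simp
    also have "(\<lambda>j. (\<Sum>l<n. Tp c i j l * y l) * (1 / s)) = (\<lambda>j. \<Sum>l<n. Tp c i j l / s * y l)"
      unfolding sum_distrib_right by simp
    finally show "L2_set (\<lambda>j. \<Sum>l<n. Tp c i j l / s * y l) {..<n} \<le> 1/2 * L2_set y {..<n}" .
  qed
  finally show ?thesis .
qed

lemma poly_norm_le:
  assumes "\<And>x. x \<in> PiE {..<n} (\<lambda>_. {-1, 1}) \<Longrightarrow> \<bar>peval n c x\<bar> \<le> K"
  shows "poly_norm n c \<le> K"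
  unfolding poly_norm_def
proof (rule cSup_least)
  show "(\<lambda>x. \<bar>peval n c x\<bar>) ` (PiE {..<n} (\<lambda>_. {-1, 1})) \<noteq> {}"
    by (simp add: PiE_eq_empty_iff)
qed (use assms in auto)

lemma two_power_le_exp: "(2::real) ^ k \<le> exp (real k)"
proof -
  have "(2::real) ^ k \<le> exp 1 ^ k"
    using exp_ge_add_one_self[of 1] by (intro power_mono) auto
  then show ?thesis by (simp flip: exp_of_nat_mult)
qed

text \<open>Outside \<open>bad\<close> all slice forms are small on the net and \<open>p\<close> is
  small at all sign vectors. Each half of \<open>bad\<close> is bounded by a union bound with
  failure probability \<open>2 * n * exp (- n)\<close>.\<close>

lemma prob_poly_cb_ge:
  assumes n: "0 < n"
  shows "1 - 4 * real n * exp (- real n) \<le> measure_pmf.prob (sign_coeffs n)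
    {coef. 1 / 3744 * sqrt (real n) * poly_norm n coef \<le> poly_cb n coef}"
proof -
  let ?P = "measure_pmf.prob (sign_coeffs n)"
  let ?good = "{coef. 1 / 3744 * sqrt (real n) * poly_norm n coef \<le> poly_cb n coef}"
  let ?I = "{..<n} \<times> grid n \<times> grid n"
  let ?X = "PiE {..<n} (\<lambda>_. {-1, 1::real})"
  define F where "F = (\<lambda>(i, z, w). {c. 13 * sqrt (real n) \<le>
      \<bar>\<Sum>j<n. \<Sum>l<n. Tp c i j l * (grid_point n z j * grid_point n w l)\<bar>})"
  define G where "G x = {c. 2 * (real n)\<^sup>2 \<le> \<bar>peval n c x\<bar>}" for x
  define bad where "bad = (\<Union>p\<in>?I. F p) \<union> (\<Union>x\<in>?X. G x)"
  have finX: "finite ?X" by (intro finite_PiE) auto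
  have "?P (\<Union>p\<in>?I. F p) \<le> (\<Sum>p\<in>?I. ?P (F p))"
    by (intro measure_UNION_le) (auto simp: finite_grid)
  \<comment> \<open>The threshold gives exponent 169/4 times \<open>n\<close>, which exceeds 37
    \<open>n\<close>. There are at most \<open>2 ^ (36 * n)\<close> pairs of net points, fewer than
    \<open>exp (36 * n)\<close>, so a factor \<open>exp (- n)\<close> remains.\<close>
  also have "\<dots> \<le> (\<Sum>p\<in>?I. 2 * exp (- 37 * real n))"
  proof (rule sum_mono)
    fix p assume "p \<in> ?I"
    then obtain i z w where p: "p = (i, z, w)" "i < n" "z \<in> grid n" "w \<in> grid n" by auto
    have "?P (F p) \<le> 2 * exp (- (13 * sqrt (real n))\<^sup>2 / 4)"
      unfolding p(1) F_def prod.case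
      using p n by (intro prob_slice_form_ge L2_set_grid_point_le_1) auto
    also have "\<dots> \<le> 2 * exp (- 37 * real n)" by (simp add: power_mult_distrib)
    finally show "?P (F p) \<le> 2 * exp (- 37 * real n)" .
  qed
  also have "\<dots> = real n * (real (card (grid n)) * real (card (grid n))) * (2 * exp (- 37 * real n))"
    by (simp add: card_cartesian_product)
  also have "\<dots> \<le> real n * (2 ^ (18 * n) * 2 ^ (18 * n)) * (2 * exp (- 37 * real n))"
    by (intro mult_right_mono mult_left_mono mult_mono card_grid_le) auto
  also have "\<dots> = real n * 2 ^ (36 * n) * (2 * exp (- 37 * real n))"
    by (simp flip: power_add)
  also have "\<dots> \<le> real n * exp (real (36 * n)) * (2 * exp (- 37 * real n))"
    by (intro mult_right_mono mult_left_mono two_power_le_exp) auto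
  also have "\<dots> = 2 * real n * (exp (real (36 * n)) * exp (- 37 * real n))" by simp
  also have "exp (real (36 * n)) * exp (- 37 * real n) = exp (- real n)"
    by (simp flip: exp_add)
  finally have PF: "?P (\<Union>p\<in>?I. F p) \<le> 2 * real n * exp (- real n)" .
  have "?P (\<Union>x\<in>?X. G x) \<le> (\<Sum>x\<in>?X. ?P (G x))"
    using finX by (intro measure_UNION_le) auto
  \<comment> \<open>The threshold 2 n^2 gives exponent 4 n^4 / (2 n^3) = 2n, enough to beat the 2^n
    sign vectors and keep \<open>exp (- n)\<close>.\<close>
  also have "\<dots> \<le> (\<Sum>x\<in>?X. 2 * exp (- 2 * real n))"
  proof (rule sum_mono)
    fix x assume "x \<in> ?X"
    then have "?P (G x) \<le> 2 * exp (- (2 * (real n)\<^sup>2)\<^sup>2 / (2 * real n ^ 3))"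
      unfolding G_def using n by (intro prob_peval_ge) auto
    also have "- (2 * (real n)\<^sup>2)\<^sup>2 / (2 * real n ^ 3) = - 2 * real n"
      using n by (simp add: field_simps power2_eq_square power3_eq_cube)
    finally show "?P (G x) \<le> 2 * exp (- 2 * real n)" .
  qed
  also have "\<dots> = 2 ^ n * (2 * exp (- 2 * real n))"
    by (simp add: card_PiE)
  also have "\<dots> \<le> exp (real n) * (2 * exp (- 2 * real n))"
    by (intro mult_right_mono two_power_le_exp) auto
  also have "\<dots> = 2 * (exp (real n) * exp (- 2 * real n))" by simp
  also have "exp (real n) * exp (- 2 * real n) = exp (- real n)"
    by (simp flip: exp_add)
  also have "2 * exp (- real n) \<le> 2 * real n * exp (- real n)" using n by simp
  finally have PG: "?P (\<Union>x\<in>?X. G x) \<le> 2 * real n * exp (- real n)" .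
  have "?P bad \<le> 4 * real n * exp (- real n)"
    unfolding bad_def using measure_Un_le[of "\<Union>p\<in>?I. F p" "sign_coeffs n" "\<Union>x\<in>?X. G x"] PF PG by simp
  moreover have "c \<in> ?good" if c: "c \<in> set_pmf (sign_coeffs n)" "c \<notin> bad" for c
  proof -
    have cb: "real n ^ 3 / (1872 * sqrt (real n)) \<le> poly_cb n c"
    proof (rule poly_cb_lower_bound[OF n])
      show "c \<alpha> \<in> {-1, 1}" if "\<alpha> \<in> cubic_monos n" for \<alpha>
        using c(1) that finite_cubic_monos by (auto simp: sign_coeffs_def set_Pi_pmf PiE_dflt_def)
      show "\<bar>\<Sum>j<n. \<Sum>l<n. Tp c i j l * (grid_point n z j * grid_point n w l)\<bar> \<le> 13 * sqrt (real n)"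
        if "i < n" "z \<in> grid n" "w \<in> grid n" for i z w
      proof -
        have "c \<notin> F (i, z, w)" using c(2) that unfolding bad_def by blast
        then show ?thesis by (simp add: F_def)
      qed
    qed
    have pn: "poly_norm n c \<le> 2 * (real n)\<^sup>2"
      using c(2) by (intro poly_norm_le) (force simp: bad_def G_def)
    \<comment> \<open>3744 = 2 * 1872: the factor 2 comes from the bound on
      \<open>poly_norm\<close>, and the two sides then agree exactly.\<close>
    have "1 / 3744 * sqrt (real n) * poly_norm n c \<le> 1 / 3744 * sqrt (real n) * (2 * (real n)\<^sup>2)"
      using pn by (intro mult_left_mono) auto
    also have "\<dots> = real n ^ 3 / (1872 * sqrt (real n))"
      using n by (simp add: field_simps power2_eq_square power3_eq_cube)
    finally show ?thesis using cb by simp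
  qed
  \<comment> \<open>Coefficients are known to be signs only on the support; intersecting with the
    support leaves probabilities unchanged.\<close>
  then have "- bad \<inter> set_pmf (sign_coeffs n) \<subseteq> ?good" by blast
  then have "?P (- bad \<inter> set_pmf (sign_coeffs n)) \<le> ?P ?good"
    by (intro measure_pmf.finite_measure_mono) auto
  moreover have "?P (- bad) = 1 - ?P bad"
    using measure_pmf.prob_compl[of bad "sign_coeffs n"] by (simp add: Compl_eq_Diff_UNIV)
  ultimately show ?thesis unfolding measure_Int_set_pmf by linarith
qed

theorem theorem4p1:
  "\<exists>C c :: real. 0 < C \<and> 0 < c \<and> (\<forall>n::nat. 0 < n \<longrightarrow>
     measure_pmf.prob (sign_coeffs n) {coef. poly_cb n coef \<ge> c * sqrt (real n) * poly_norm n coef}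
       \<ge> 1 - C * real n * exp (- c * real n))"
proof (intro exI conjI allI impI)
  fix n :: nat assume n: "0 < n"
  \<comment> \<open>A single constant serves as factor and as decay rate, so the rate 1 is weakened
    to 1/3744.\<close>
  have "1 - 4 * real n * exp (- (1 / 3744) * real n) \<le> 1 - 4 * real n * exp (- real n)"
    by (intro diff_left_mono mult_left_mono) auto
  also note prob_poly_cb_ge[OF n]
  finally show "1 - 4 * real n * exp (- (1 / 3744) * real n) \<le> measure_pmf.prob (sign_coeffs n)
      {coef. 1 / 3744 * sqrt (real n) * poly_norm n coef \<le> poly_cb n coef}" .
qed simp_all

end
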